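(* Let $N$ be a positive integer, $\Omega=\{-1,+1\}^N$, let $\mu_N$ be the Gibbs measure of the one-dimensional periodic Ising model with coupling constant $\hat J$, and let $P_{\mathrm W}(\sigma,\eta)=\mathbb P(Y_2=\eta\mid Y_1=\sigma)$ be the transition kernel of the Wolff dynamics $(Y_k)_{k\ge 1}$ with coupling constant $\hat J$. Put $\kappa=1-e^{-2\hat J}$ and $\hat\kappa=e^{-2\hat J}$. Then the following hold. (1) Let $\hat J\in(0,+\infty)$ and $\sigma\in\Omega$. If $A\subset[N]$ is connected and $\sigma_i\sigma_j=+1$ for all $i,j\in A$, then $$P_{\mathrm W}(\sigma,\sigma^A)=\frac{\#\{A\}}{N}\begin{cases}\kappa^{\#\{A\}-1}\hat\kappa^2, & \#\{\partial A\cap\mathcal B_+^\sigma\}=2,\\ \kappa^{\#\{A\}-1}\hat\kappa, & \#\{\partial A\cap\mathcal B_+^\sigma\}=1,\\ \kappa^{\#\{A\}-1}, & \partial A\subset\mathcal B_-^\sigma,\ \#\{\partial A\}\neq 0,\\ (N\hat\kappa+\kappa)\kappa^{N-1}, & \tilde{\mathcal C}^\sigma\tilde{\mathcal D}^\sigma=0,\ \#\{A\}=N.\end{cases}$$ Moreover, with $\mathcal K_r^\sigma\in\{\mathcal C_r^\sigma,\mathcal D_r^\sigma\}$ denoting a connected component of $\mathcal C^\sigma$ or of $\mathcal D^\sigma$, $$P_{\mathrm W}(\sigma,\sigma^A)=\frac{\#\{A\}}{N}\begin{cases}1, & \exists r:\ A\subset\mathcal K_r^\sigma,\ \#\{\hat\partial\mathcal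 K_r^\sigma\}=1,\\ \kappa^{\#\{A\}-1}\hat\kappa^2, & \exists r:\ A\subset\mathcal K_r^\sigma,\ \#\{\hat\partial\mathcal K_r^\sigma\}=2,\ \#\{A\cap\hat\partial\mathcal K_r^\sigma\}=0,\\ \kappa^{\#\{A\}-1}\hat\kappa, & \exists r:\ A\subset\mathcal K_r^\sigma,\ \#\{\hat\partial\mathcal K_r^\sigma\}=2,\ \#\{A\cap\hat\partial\mathcal K_r^\sigma\}=1,\\ \kappa^{\#\{A\}-1}, & \exists r:\ A\subset\mathcal K_r^\sigma,\ \#\{A\cap\hat\partial\mathcal K_r^\sigma\}=2,\\ \kappa^{\#\{A\}-1}\hat\kappa^2, & \tilde{\mathcal C}^\sigma\tilde{\mathcal D}^\sigma=0,\ \#\{A\}\le N-1,\\ (N\hat\kappa+\kappa)\kappa^{N-1}, & \tilde{\mathcal C}^\sigma\tilde{\mathcal D}^\sigma=0,\ \#\{A\}=N.\end{cases}$$ If $A\subset[N]$ is not connected, or if $A$ fails to satisfy $\sigma_i\sigma_j=+1$ for all $i,j\in A$, then $P_{\mathrm W}(\sigma,\sigma^A)=0$. In addition, for $\hat J=0$ and every $\sigma\in\Omega$: $P_{\mathrm W}(\sigma,\sigma^A)=0$ for all $A\subset[N]$ with $\#\{A\}\ge2$, and $P_{\mathrm W}(\sigma,\sigma^{\{i\}})=\frac1N$ for every $i\in[N]$. Hence for $\hat J=0$ the Wolff dynamics is the simple random walk on the hypercube $\Omega$. (2) For every $\hat J\in[0,+\infty)$ and all $\eta,\sigma\in\Omega$,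 $$\mu_N(\eta)P_{\mathrm W}(\eta,\sigma)=\mu_N(\sigma)P_{\mathrm W}(\sigma,\eta).$$
   Context: Indices in $[N]=\{1,\dots,N\}$ are cyclic ($N+1\equiv1$, $0\equiv N$). The Gibbs measure is $\mu_N(\sigma)=Z_N^{-1}\exp\big(\hat J\sum_{i=1}^N\sigma_i\sigma_{i+1}\big)$ on $\Omega$, with $Z_N$ the normalizing constant. $G=([N],\mathcal G)$ is the undirected cycle with the $N$ edges $\{i,i+1\}$, $i=1,\dots,N$ (counted with multiplicity if $N=2$). $\#\{V\}$ denotes cardinality. For $A\subset[N]$, $\sigma^A$ is $\sigma$ with the spins at all sites of $A$ flipped. Wolff dynamics: a Markov chain $(Y_k)_{k\ge1}$ on $\Omega$; one step from $\sigma$ is as follows. Choose a site $i_0\in[N]$ uniformly at random and start the cluster with $i_0$. Repeatedly, for each site $i$ in the cluster and each edge joining $i$ to a neighbour $j$ with $\sigma_j=\sigma_i$ such that this edge has not been considered before, add $j$ to the cluster with probability $1-e^{-\hat J(1+\sigma_i\sigma_j)}=1-e^{-2\hat J}$, independently over edges. When no edge remains to be considered, flip all spins of the cluster (with probability 1). Equivalently: declare each edge with aligned endpoint spins open independently with probability $1-e^{-2\hat J}$ (all other edges are closed), and flip the open-connected component of $i_0$. For $\sigma\in\Omega$: $\mathcal B_+^\sigma$ (resp. $\mathcal B_-^\sigma$) is the set of edges whose endpoint spins have product $+1$ (resp. $-1$); $\mathcal C^\sigma=\{k\in[N]:\sigma_k=+1\}$ and $\mathcal D^\sigma=\{k\in[N]:\sigma_k=-1\}$.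 A subset of $[N]$ is connected if it is the vertex set of a (nonempty) connected subgraph of $G$. $\mathcal C^\sigma=\bigcup_{r=1}^{\tilde{\mathcal C}^\sigma}\mathcal C_r^\sigma$ and $\mathcal D^\sigma=\bigcup_{r=1}^{\tilde{\mathcal D}^\sigma}\mathcal D_r^\sigma$ are the decompositions into pairwise disjoint connected components, and $\tilde{\mathcal C}^\sigma,\tilde{\mathcal D}^\sigma$ are the numbers of components (so $\tilde{\mathcal C}^\sigma\tilde{\mathcal D}^\sigma=0$ iff all spins of $\sigma$ are equal). The edge boundary $\partial A$ of $A\subset[N]$ is the set of edges with one endpoint in $A$ and the other outside $A$. The vertex boundary of $V\subset[N]$ is $\hat\partial V=\{k\in V: k+1\notin V\text{ or }k-1\notin V\}$ (indices cyclic). *)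

theory Defs
  imports "HOL-Probability.Probability_Mass_Function"
begin

text \<open>Sites are the elements of \<open>{1..N}\<close>, read cyclically. For \<open>N = 1\<close> both neighbours of the
  single site are the site itself.\<close>

definition nxt :: "nat \<Rightarrow> nat \<Rightarrow> nat" where
  "nxt N i = (if i = N then 1 else i + 1)"

definition prv :: "nat \<Rightarrow> nat \<Rightarrow> nat" where
  "prv N i = (if i = 1 then N else i - 1)"

definition configs :: "nat \<Rightarrow> (nat \<Rightarrow> real) set" where
  "configs N = {1..N} \<rightarrow>\<^sub>E {-1, 1}"

definition flip :: "nat set \<Rightarrow> (nat \<Rightarrow> real) \<Rightarrow> nat \<Rightarrow> real" where
  "flip A \<sigma> = (\<lambda>i. if i \<in> A then - \<sigma> i else \<sigma> i)"

definition aligned :: "(nat \<Rightarrow> real) \<Rightarrow> nat set \<Rightarrow> bool" where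
  "aligned \<sigma> A \<longleftrightarrow> (\<forall>i\<in>A. \<forall>j\<in>A. \<sigma> i * \<sigma> j = 1)"

definition kappa :: "real \<Rightarrow> real" where
  "kappa J = 1 - exp (- 2 * J)"

definition kappa_hat :: "real \<Rightarrow> real" where
  "kappa_hat J = exp (- 2 * J)"


subsection \<open>Gibbs measure\<close>

definition gibbs_weight :: "nat \<Rightarrow> real \<Rightarrow> (nat \<Rightarrow> real) \<Rightarrow> real" where
  "gibbs_weight N J \<sigma> = exp (J * (\<Sum>i = 1..N. \<sigma> i * \<sigma> (nxt N i)))"

definition gibbs :: "nat \<Rightarrow> real \<Rightarrow> (nat \<Rightarrow> real) \<Rightarrow> real" where
  "gibbs N J \<sigma> = gibbs_weight N J \<sigma> / (\<Sum>\<tau>\<in>configs N. gibbs_weight N J \<tau>)"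


subsection \<open>The cycle\<close>

text \<open>The edge joining \<open>e\<close> and \<open>nxt N e\<close> is represented by the number \<open>e \<in> {1..N}\<close>, so that there
  are always \<open>N\<close> edges: for \<open>N = 2\<close> the edges 1 and 2 are parallel, for \<open>N = 1\<close> the edge is a loop.\<close>

definition ends :: "nat \<Rightarrow> nat \<Rightarrow> nat set" where
  "ends N e = {e, nxt N e}"

definition connected_graph :: "nat \<Rightarrow> nat set \<Rightarrow> nat set \<Rightarrow> bool" where
  "connected_graph N V F \<longleftrightarrow>
     V \<noteq> {} \<and> (\<forall>i\<in>V. \<forall>j\<in>V. (i, j) \<in> {(x, y). \<exists>e\<in>F. ends N e = {x, y}}\<^sup>*)"

definition connected_sites :: "nat \<Rightarrow> nat set \<Rightarrow> bool" where
  "connected_sites N A \<longleftrightarrow> A \<subseteq> {1..N} \<and>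
     (\<exists>F\<subseteq>{1..N}. (\<forall>e\<in>F. ends N e \<subseteq> A) \<and> connected_graph N A F)"

definition cycle_components :: "nat \<Rightarrow> nat set \<Rightarrow> nat set set" where
  "cycle_components N V = {K. K \<subseteq> V \<and> connected_sites N K \<and>
     (\<forall>K'. K \<subseteq> K' \<and> K' \<subseteq> V \<and> connected_sites N K' \<longrightarrow> K' = K)}"

definition edge_boundary :: "nat \<Rightarrow> nat set \<Rightarrow> nat set" where
  "edge_boundary N A = {e \<in> {1..N}. (e \<in> A) \<noteq> (nxt N e \<in> A)}"

definition vertex_boundary :: "nat \<Rightarrow> nat set \<Rightarrow> nat set" where
  "vertex_boundary N V = {k \<in> V. nxt N k \<notin> V \<or> prv N k \<notin> V}"

definition B_plus :: "nat \<Rightarrow> (nat \<Rightarrow> real) \<Rightarrow> nat set" where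
  "B_plus N \<sigma> = {e \<in> {1..N}. \<sigma> e * \<sigma> (nxt N e) = 1}"

definition B_minus :: "nat \<Rightarrow> (nat \<Rightarrow> real) \<Rightarrow> nat set" where
  "B_minus N \<sigma> = {e \<in> {1..N}. \<sigma> e * \<sigma> (nxt N e) = - 1}"

definition C_comps :: "nat \<Rightarrow> (nat \<Rightarrow> real) \<Rightarrow> nat set set" where
  "C_comps N \<sigma> = cycle_components N {k \<in> {1..N}. \<sigma> k = 1}"

definition D_comps :: "nat \<Rightarrow> (nat \<Rightarrow> real) \<Rightarrow> nat set set" where
  "D_comps N \<sigma> = cycle_components N {k \<in> {1..N}. \<sigma> k = - 1}"


subsection \<open>Wolff dynamics\<close>

text \<open>The edges still to be considered when the current cluster is \<open>C\<close> and the edges in \<open>S\<close> have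
  already been considered.\<close>

definition frontier_edges :: "nat \<Rightarrow> (nat \<Rightarrow> real) \<Rightarrow> nat set \<Rightarrow> nat set \<Rightarrow> nat set" where
  "frontier_edges N \<sigma> C S =
     {e \<in> {1..N}. e \<notin> S \<and> ends N e \<inter> C \<noteq> {} \<and> \<sigma> e = \<sigma> (nxt N e)}"

text \<open>The order in which the edges are considered is arbitrary. One endpoint of a frontier edge is
  already in the cluster, so adding both endpoints amounts to adding the other one.\<close>

function grow_cluster ::
  "nat \<Rightarrow> real \<Rightarrow> (nat \<Rightarrow> real) \<Rightarrow> nat set \<Rightarrow> nat set \<Rightarrow> nat set pmf" where
  "grow_cluster N J \<sigma> C S =
     (if frontier_edges N \<sigma> C S = {} then return_pmf C
      else let e = (SOME e. e \<in> frontier_edges N \<sigma> C S) in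
        do {
          b \<leftarrow> bernoulli_pmf (1 - exp (- J * (1 + \<sigma> e * \<sigma> (nxt N e))));
          grow_cluster N J \<sigma> (if b then C \<union> ends N e else C) (insert e S)
        })"
  by pat_completeness auto
termination
proof (relation "Wellfounded.measure (\<lambda>(N, J, \<sigma>, C, S). card ({1..N} - S))", goal_cases)
  case 1
  show ?case by simp
next
  case (2 N J \<sigma> C S e b)
  have "e \<in> frontier_edges N \<sigma> C S"
    using 2 some_in_eq[of "frontier_edges N \<sigma> C S"] by simp
  then have "e \<in> {1..N} - S"
    by (simp add: frontier_edges_def)
  then have "{1..N} - insert e S \<subset> {1..N} - S"
    by blast
  then show ?case
    by (simp add: psubset_card_mono)
qed

declare grow_cluster.simps [simp del]

definition wolff :: "nat \<Rightarrow> real \<Rightarrow> (nat \<Rightarrow> real) \<Rightarrow> (nat \<Rightarrow> real) pmf" where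
  "wolff N J \<sigma> =
     do {
       i\<^sub>0 \<leftarrow> pmf_of_set {1..N};
       C \<leftarrow> grow_cluster N J \<sigma> {i\<^sub>0} {};
       return_pmf (flip C \<sigma>)
     }"

definition P_W :: "nat \<Rightarrow> real \<Rightarrow> (nat \<Rightarrow> real) \<Rightarrow> (nat \<Rightarrow> real) \<Rightarrow> real" where
  "P_W N J \<sigma> \<eta> = pmf (wolff N J \<sigma>) \<eta>"

definition hypercube_neighbours :: "nat \<Rightarrow> (nat \<Rightarrow> real) \<Rightarrow> (nat \<Rightarrow> real) set" where
  "hypercube_neighbours N \<sigma> = {\<eta> \<in> configs N. card {i \<in> {1..N}. \<eta> i \<noteq> \<sigma> i} = 1}"

definition hypercube_srw :: "nat \<Rightarrow> (nat \<Rightarrow> real) \<Rightarrow> (nat \<Rightarrow> real) pmf" where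
  "hypercube_srw N \<sigma> = pmf_of_set (hypercube_neighbours N \<sigma>)"


subsection \<open>Definitions by cases\<close>

text \<open>The displayed formula ``\<open>x = v\<^sub>1\<close> if \<open>c\<^sub>1\<close>, \<dots>, \<open>x = v\<^sub>n\<close> if \<open>c\<^sub>n\<close>'': at least one of the
  conditions holds, and every condition that holds determines the value.\<close>

definition by_cases :: "real \<Rightarrow> (real \<times> bool) list \<Rightarrow> bool" where
  "by_cases x cs \<longleftrightarrow> (\<exists>(v, c)\<in>set cs. c) \<and> (\<forall>(v, c)\<in>set cs. c \<longrightarrow> x = v)"

end

theory Submission
  imports Defs
begin

text \<open>
  The cluster of the Wolff dynamics is the open component of the starting site in an independent
  percolation on the aligned edges, each of which is open with probability \<open>kappa J\<close>. The growth
  procedure merely reveals this percolation edge by edge (\<open>pmf_grow_cluster\<close>), so its law can be read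
  off from the geometry of the cycle.

  A connected set of sites other than the whole cycle is an arc: it has exactly one edge leaving it in
  each direction, and its inner edges form a tree (\<open>connected_proper_cards\<close>). Both facts follow by
  counting edges, as a connected graph on \<open>n\<close> vertices has at least \<open>n - 1\<close> edges. Hence the cluster of
  a site of an aligned arc \<open>A\<close> equals \<open>A\<close> exactly if all \<open>card A - 1\<close> inner edges are open and the aligned
  boundary edges are closed (\<open>reach_eq_proper_iff\<close>), which has probability
  \<open>kappa J ^ (card A - 1) * kappa_hat J ^ b\<close>, where \<open>b\<close> is the number of aligned boundary edges. The
  whole cycle is one edge more than a tree, so at most one of its \<open>N\<close> edges may be closed
  (\<open>reach_eq_ring_iff\<close>), which has probability
  \<open>kappa J ^ N + N * kappa J ^ (N - 1) * kappa_hat J\<close>. Averaging over the starting site gives the kernel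
  (\<open>wolff_kernel\<close>). It holds for every \<open>J \<ge> 0\<close>.

  The two lists of cases are evaluations of \<open>b\<close>. For the second one, the two ends of the component of
  equal spin around \<open>A\<close> are compared with the two ends of \<open>A\<close>: an end of the component lies in \<open>A\<close>
  exactly if \<open>A\<close> has no aligned boundary edge on that side (\<open>aligned_boundary_in_component\<close>).

  For reversibility, flipping \<open>A\<close> changes only the products of spins across the boundary of \<open>A\<close>, and the
  Gibbs weight times \<open>kappa_hat J ^ b\<close> turns out to be invariant under the flip
  (\<open>gibbs_weight_boundary\<close>). The other factors of the kernel depend on \<open>A\<close> only. At \<open>J = 0\<close> no edge
  is ever open and the dynamics flips a uniformly chosen single spin.
\<close>

section \<open>Clusters of open edges\<close>

definition reach :: "nat \<Rightarrow> nat set \<Rightarrow> nat set \<Rightarrow> nat set" where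
  "reach N F C = {(x, y). \<exists>e\<in>F. ends N e = {x, y}}\<^sup>* `` C"

definition inner_edges :: "nat \<Rightarrow> nat set \<Rightarrow> nat set" where
  "inner_edges N A = {e \<in> {1..N}. ends N e \<subseteq> A}"

lemma subset_reach: "C \<subseteq> reach N F C"
  by (auto simp: reach_def)

lemma reach_mono: "F \<subseteq> F' \<Longrightarrow> C \<subseteq> C' \<Longrightarrow> reach N F C \<subseteq> reach N F' C'"
  unfolding reach_def by (intro Image_mono rtrancl_mono) auto

lemma reach_closed:
  assumes "e \<in> F" "ends N e \<inter> reach N F C \<noteq> {}"
  shows "ends N e \<subseteq> reach N F C"
proof -
  let ?R = "{(x, y). \<exists>e\<in>F. ends N e = {x, y}}"
  from assms(2) obtain x where x: "x \<in> ends N e" "x \<in> reach N F C"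
    by blast
  show ?thesis
  proof
    fix y assume "y \<in> ends N e"
    show "y \<in> reach N F C"
    proof (cases "y = x")
      case False
      with x(1) \<open>y \<in> ends N e\<close> have "ends N e = {x, y}"
        by (auto simp: ends_def)
      with assms(1) have "(x, y) \<in> ?R"
        by blast
      with x(2) show ?thesis
        unfolding reach_def by (auto intro: rtrancl_into_rtrancl)
    qed (use x in simp)
  qed
qed

lemma reach_least:
  assumes "C \<subseteq> X" and closed: "\<And>e. e \<in> F \<Longrightarrow> ends N e \<inter> X \<noteq> {} \<Longrightarrow> ends N e \<subseteq> X"
  shows "reach N F C \<subseteq> X"
proof
  fix y assume "y \<in> reach N F C"
  then obtain x where "x \<in> C" and xy: "(x, y) \<in> {(x, y). \<exists>e\<in>F. ends N e = {x, y}}\<^sup>*"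
    by (auto simp: reach_def)
  from xy show "y \<in> X"
  proof induction
    case base
    show ?case using \<open>x \<in> C\<close> assms(1) by blast
  next
    case (step y z)
    then obtain e where "e \<in> F" "ends N e = {y, z}" by blast
    with closed[of e] step.IH show ?case by blast
  qed
qed

lemma reach_eqI:
  assumes "C \<subseteq> X" "X \<subseteq> reach N F C"
    "\<And>e. e \<in> F \<Longrightarrow> ends N e \<inter> X \<noteq> {} \<Longrightarrow> ends N e \<subseteq> X"
  shows "reach N F C = X"
  using reach_least[OF assms(1,3)] assms(2) by blast

lemma reach_untouched:
  assumes "\<And>e. e \<in> F \<Longrightarrow> ends N e \<inter> C = {}"
  shows "reach N F C = C"
  using assms by (intro reach_eqI subset_reach) auto

text \<open>This is one step of the exploration of a cluster: an open edge that touches the current set may be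
  spent at once, and does not have to be looked at again. The growth procedure of the Wolff dynamics
  follows this recursion, and so does the count of vertices below.\<close>

lemma reach_explore:
  assumes "e \<in> F" "ends N e \<inter> C \<noteq> {}"
  shows "reach N F C = reach N (F - {e}) (C \<union> ends N e)"
proof (rule reach_eqI)
  let ?R = "reach N (F - {e}) (C \<union> ends N e)"
  have sub: "C \<union> ends N e \<subseteq> ?R"
    by (rule subset_reach)
  then show "C \<subseteq> ?R" by blast
  have "ends N e \<inter> reach N F C \<noteq> {}"
    using assms(2) subset_reach[of C N F] by blast
  then have "ends N e \<subseteq> reach N F C"
    by (rule reach_closed[OF assms(1)])
  then show "?R \<subseteq> reach N F C"
    by (intro reach_least) (use subset_reach[of C N F] reach_closed[of _ F] in auto)
  fix f assume "f \<in> F" "ends N f \<inter> ?R \<noteq> {}"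
  then show "ends N f \<subseteq> ?R"
    using sub reach_closed[of f "F - {e}" N "C \<union> ends N e"] by (cases "f = e") auto
qed

text \<open>Every edge that the exploration spends adds at most one new vertex. For a single starting vertex
  this says that a connected graph on \<open>n\<close> vertices has at least \<open>n - 1\<close> edges.\<close>

lemma card_reach_le:
  assumes "finite F" "finite C"
  shows "finite (reach N F C) \<and> card (reach N F C) \<le> card C + card F"
  using assms
proof (induction "card F" arbitrary: F C)
  case 0
  then show ?case using reach_untouched[of F N C] by simp
next
  case (Suc n)
  show ?case
  proof (cases "\<exists>e\<in>F. ends N e \<inter> C \<noteq> {}")
    case True
    then obtain e where e: "e \<in> F" "ends N e \<inter> C \<noteq> {}" by blast
    have fin: "finite (C \<union> ends N e)"
      using Suc.prems by (simp add: ends_def)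
    obtain x where "C \<union> ends N e \<subseteq> insert x C"
      using e(2) by (auto simp: ends_def)
    then have "card (C \<union> ends N e) \<le> card (insert x C)"
      using Suc.prems by (intro card_mono) auto
    also have "\<dots> \<le> card C + 1"
      using Suc.prems by (simp add: card_insert_if)
    finally have "card (C \<union> ends N e) \<le> card C + 1" .
    moreover have "n = card (F - {e})"
      using Suc e by simp
    ultimately show ?thesis
      using Suc.hyps(1)[of "F - {e}" "C \<union> ends N e"] Suc.hyps(2) Suc.prems fin
      by (auto simp: reach_explore[OF e])
  next
    case False
    then have "reach N F C = C"
      by (intro reach_untouched) auto
    then show ?thesis using Suc.prems by simp
  qed
qed

lemma reach_sym:
  assumes "y \<in> reach N F {x}"
  shows "x \<in> reach N F {y}"
proof -
  let ?R = "{(x, y). \<exists>e\<in>F. ends N e = {x, y}}"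
  have "sym (?R\<^sup>*)"
    by (rule sym_rtrancl) (auto simp: sym_def insert_commute)
  then show ?thesis
    using assms by (auto simp: reach_def dest: symD)
qed

lemma reach_trans:
  assumes "y \<in> reach N F {x}"
  shows "reach N F {y} \<subseteq> reach N F {x}"
  using assms by (intro reach_least) (auto dest: reach_closed)

section \<open>Connected sets of sites\<close>

lemma nxt_in: "e \<in> {1..N} \<Longrightarrow> nxt N e \<in> {1..N}"
  by (auto simp: nxt_def)

lemma ends_subset: "e \<in> {1..N} \<Longrightarrow> ends N e \<subseteq> {1..N}"
  using nxt_in[of e N] by (auto simp: ends_def)

lemma reach_subset:
  assumes "F \<subseteq> {1..N}" "C \<subseteq> {1..N}"
  shows "reach N F C \<subseteq> {1..N}"
  by (intro reach_least) (use assms ends_subset in blast)+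

lemma reach_inner_subset: "C \<subseteq> A \<Longrightarrow> reach N (inner_edges N A) C \<subseteq> A"
  by (intro reach_least) (auto simp: inner_edges_def)

text \<open>A subgraph that witnesses connectedness of \<open>A\<close> may be enlarged to all edges inside \<open>A\<close>, and by
  symmetry of reachability one starting vertex is as good as any other. So connectedness amounts to
  the condition that the inner edges of \<open>A\<close> reach all of \<open>A\<close> from one of its sites.\<close>

lemma connected_sitesD:
  assumes "connected_sites N A"
  shows "A \<subseteq> {1..N}" "A \<noteq> {}" "\<And>i. i \<in> A \<Longrightarrow> reach N (inner_edges N A) {i} = A"
proof -
  from assms obtain F where F: "F \<subseteq> {1..N}" "\<forall>e\<in>F. ends N e \<subseteq> A" "connected_graph N A F"
    and A: "A \<subseteq> {1..N}"
    by (auto simp: connected_sites_def)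
  show "A \<subseteq> {1..N}" by fact
  show "A \<noteq> {}" using F by (simp add: connected_graph_def)
  fix i assume i: "i \<in> A"
  have "F \<subseteq> inner_edges N A"
    using F by (auto simp: inner_edges_def)
  then have "reach N F {i} \<subseteq> reach N (inner_edges N A) {i}"
    by (intro reach_mono) auto
  moreover have "A \<subseteq> reach N F {i}"
    using F(3) i by (auto simp: reach_def connected_graph_def)
  ultimately show "reach N (inner_edges N A) {i} = A"
    using reach_inner_subset[of "{i}" A N] i by blast
qed

lemma connected_sitesI:
  assumes "A \<subseteq> {1..N}" "x \<in> A" "A \<subseteq> reach N (inner_edges N A) {x}"
  shows "connected_sites N A"
proof -
  have "A \<subseteq> reach N (inner_edges N A) {i}" if "i \<in> A" for i
    using that assms(3) reach_sym[of i N _ x] reach_trans[of x N _ i] by blast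
  then have "connected_graph N A (inner_edges N A)"
    using assms(2) unfolding connected_graph_def reach_def by blast
  then show ?thesis
    using assms(1) unfolding connected_sites_def
    by (intro conjI exI[of _ "inner_edges N A"]) (auto simp: inner_edges_def)
qed

text \<open>This is the form in which connectedness is used to show that a set is as small as it looks.\<close>

lemma connected_sites_closed_subset:
  assumes "connected_sites N A" "X \<subseteq> A" "X \<noteq> {}"
    "\<And>e. e \<in> inner_edges N A \<Longrightarrow> ends N e \<inter> X \<noteq> {} \<Longrightarrow> ends N e \<subseteq> X"
  shows "X = A"
proof -
  obtain x where "x \<in> X" using assms(3) by blast
  then have "reach N (inner_edges N A) {x} \<subseteq> X"
    using assms(4) by (intro reach_least) auto
  moreover have "reach N (inner_edges N A) {x} = A"
    using connected_sitesD(3)[OF assms(1)] \<open>x \<in> X\<close> assms(2) by blast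
  ultimately show ?thesis using assms(2) by blast
qed

text \<open>A path of open edges that starts in the cluster stays in it, so it uses only inner edges of the
  cluster.\<close>

lemma connected_sites_reach:
  assumes "F \<subseteq> {1..N}" "i \<in> {1..N}"
  shows "connected_sites N (reach N F {i})"
proof -
  define A where "A = reach N F {i}"
  let ?X = "reach N (inner_edges N A) {i}"
  have iA: "i \<in> A" using subset_reach[of "{i}" N F] by (simp add: A_def)
  have XA: "?X \<subseteq> A" using iA by (intro reach_inner_subset) simp
  have "A \<subseteq> ?X"
    unfolding A_def
  proof (rule reach_least)
    fix e assume e: "e \<in> F" "ends N e \<inter> reach N (inner_edges N (reach N F {i})) {i} \<noteq> {}"
    then have "ends N e \<inter> A \<noteq> {}" using XA unfolding A_def by blast
    then have "ends N e \<subseteq> A" using e(1) reach_closed unfolding A_def by blast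
    then have "e \<in> inner_edges N A" using e(1) assms by (auto simp: inner_edges_def)
    then show "ends N e \<subseteq> reach N (inner_edges N (reach N F {i})) {i}"
      using e(2) reach_closed unfolding A_def by blast
  qed (rule subset_reach)
  moreover have "A \<subseteq> {1..N}"
    using assms unfolding A_def by (intro reach_subset) auto
  ultimately show ?thesis
    using connected_sitesI iA unfolding A_def by blast
qed

lemma connected_sites_extend:
  assumes "connected_sites N K" "e \<in> {1..N}" "ends N e \<inter> K \<noteq> {}"
  shows "connected_sites N (K \<union> ends N e)"
proof -
  let ?K = "K \<union> ends N e"
  obtain x where x: "x \<in> ends N e" "x \<in> K" using assms(3) by blast
  have e: "e \<in> inner_edges N ?K" using assms(2) by (simp add: inner_edges_def)
  have "K = reach N (inner_edges N K) {x}"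
    using connected_sitesD(3)[OF assms(1) x(2)] by simp
  also have "\<dots> \<subseteq> reach N (inner_edges N ?K) {x}"
    by (intro reach_mono) (auto simp: inner_edges_def)
  finally have K: "K \<subseteq> reach N (inner_edges N ?K) {x}" .
  then have "ends N e \<subseteq> reach N (inner_edges N ?K) {x}"
    using x by (intro reach_closed[OF e]) blast
  with K show ?thesis
    using connected_sitesD(1)[OF assms(1)] ends_subset[OF assms(2)] x
    by (intro connected_sitesI[of _ _ x]) auto
qed

section \<open>Boundaries of arcs\<close>

lemma bij_nxt: "bij_betw (nxt N) {1..N} {1..N}"
proof -
  have "inj_on (nxt N) {1..N}"
    by (auto simp: inj_on_def nxt_def split: if_splits)
  moreover have "nxt N ` {1..N} \<subseteq> {1..N}"
    using nxt_in[of _ N] by auto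
  ultimately show ?thesis
    by (simp add: bij_betw_def endo_inj_surj)
qed

lemma prv_nxt: "e \<in> {1..N} \<Longrightarrow> prv N (nxt N e) = e"
  by (auto simp: nxt_def prv_def)

lemma nxt_prv: "k \<in> {1..N} \<Longrightarrow> nxt N (prv N k) = k \<and> prv N k \<in> {1..N}"
  by (auto simp: nxt_def prv_def)

text \<open>On the oriented cycle the boundary edges of a set are of two kinds, those along which a walk in the
  direction of \<open>nxt\<close> leaves the set and those along which it enters. An edge of one kind is never of
  the other, even for \<open>N = 2\<close>, where both edges have the same endpoints.\<close>

definition exit_edges :: "nat \<Rightarrow> nat set \<Rightarrow> nat set" where
  "exit_edges N A = {e \<in> {1..N}. e \<in> A \<and> nxt N e \<notin> A}"

definition entry_edges :: "nat \<Rightarrow> nat set \<Rightarrow> nat set" where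
  "entry_edges N A = {e \<in> {1..N}. e \<notin> A \<and> nxt N e \<in> A}"

lemma exit_edge:
  assumes "exit_edges N A = {r}"
  shows "r \<in> {1..N}" "r \<in> A" "nxt N r \<notin> A"
    and "k \<in> {1..N} \<Longrightarrow> k \<in> A \<Longrightarrow> nxt N k \<notin> A \<Longrightarrow> k = r"
proof -
  have *: "k \<in> exit_edges N A \<longleftrightarrow> k = r" for k by (simp add: assms)
  show "r \<in> {1..N}" "r \<in> A" "nxt N r \<notin> A"
    and "k \<in> {1..N} \<Longrightarrow> k \<in> A \<Longrightarrow> nxt N k \<notin> A \<Longrightarrow> k = r"
    using *[of r] *[of k] by (simp_all add: exit_edges_def)
qed

lemma entry_edge:
  assumes "entry_edges N A = {l}"
  shows "l \<in> {1..N}" "l \<notin> A" "nxt N l \<in> A"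
    and "k \<in> {1..N} \<Longrightarrow> k \<notin> A \<Longrightarrow> nxt N k \<in> A \<Longrightarrow> k = l"
proof -
  have *: "k \<in> entry_edges N A \<longleftrightarrow> k = l" for k by (simp add: assms)
  show "l \<in> {1..N}" "l \<notin> A" "nxt N l \<in> A"
    and "k \<in> {1..N} \<Longrightarrow> k \<notin> A \<Longrightarrow> nxt N k \<in> A \<Longrightarrow> k = l"
    using *[of l] *[of k] by (simp_all add: entry_edges_def)
qed

lemma edge_boundary_split:
  "edge_boundary N A = exit_edges N A \<union> entry_edges N A" "exit_edges N A \<inter> entry_edges N A = {}"
  by (auto simp: edge_boundary_def exit_edges_def entry_edges_def)

text \<open>Without an exit the set would be closed under \<open>nxt\<close>, and iterating \<open>nxt\<close> from any site visits the
  whole cycle.\<close>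

lemma exit_edges_nonempty:
  assumes "A \<subseteq> {1..N}" "A \<noteq> {}" "A \<noteq> {1..N}"
  shows "exit_edges N A \<noteq> {}"
proof
  assume "exit_edges N A = {}"
  then have closed: "nxt N e \<in> A" if "e \<in> A" for e
    using that assms(1) by (auto simp: exit_edges_def)
  obtain a where a: "a \<in> A" using assms(2) by blast
  have up: "j \<in> A" if "i \<in> A" "i \<le> j" "j \<le> N" for i j
    using that(2,1,3)
  proof (induction rule: dec_induct)
    case (step k)
    then show ?case using closed[of k] by (auto simp: nxt_def)
  qed
  have "N \<in> A" using up[of a N] a assms(1) by auto
  then have "1 \<in> A" using closed[of N] by (simp add: nxt_def)
  then have "{1..N} \<subseteq> A" using up[of 1] by auto
  with assms show False by blast
qed

lemma entry_edges_compl: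
  "entry_edges N A = exit_edges N ({1..N} - A)"
  using nxt_in[of _ N] by (auto simp: exit_edges_def entry_edges_def)

text \<open>A walk enters a set where it leaves the complement.\<close>

lemma entry_edges_nonempty:
  assumes "A \<subseteq> {1..N}" "A \<noteq> {}" "A \<noteq> {1..N}"
  shows "entry_edges N A \<noteq> {}"
  unfolding entry_edges_compl using assms by (intro exit_edges_nonempty) auto

text \<open>An edge that starts in \<open>A\<close> either stays inside or exits.\<close>

lemma card_inner_exit:
  assumes "A \<subseteq> {1..N}"
  shows "card (inner_edges N A) + card (exit_edges N A) = card A"
proof -
  have "A = inner_edges N A \<union> exit_edges N A" "inner_edges N A \<inter> exit_edges N A = {}"
    using assms by (auto simp: inner_edges_def exit_edges_def ends_def)
  then show ?thesis
    using card_Un_disjoint[of "inner_edges N A" "exit_edges N A"]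
    by (auto simp: inner_edges_def exit_edges_def)
qed

text \<open>The same count by end points instead of starting points, since \<open>nxt\<close> permutes the sites.\<close>

lemma card_inner_entry:
  assumes "A \<subseteq> {1..N}"
  shows "card (inner_edges N A) + card (entry_edges N A) = card A"
proof -
  let ?P = "{e \<in> {1..N}. nxt N e \<in> A}"
  have "nxt N ` ?P = nxt N ` {1..N} \<inter> A"
    by auto
  then have "nxt N ` ?P = A"
    using assms bij_nxt[of N] by (simp only: bij_betw_def Int_absorb1)
  moreover have "inj_on (nxt N) ?P"
    using inj_on_subset[of "nxt N" "{1..N}" ?P] bij_nxt[of N] by (simp add: bij_betw_def subset_eq)
  ultimately have "card A = card ?P"
    using card_image[of "nxt N" ?P] by simp
  also have "?P = inner_edges N A \<union> entry_edges N A"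
    by (auto simp: inner_edges_def entry_edges_def ends_def)
  also have "card \<dots> = card (inner_edges N A) + card (entry_edges N A)"
    by (intro card_Un_disjoint) (auto simp: inner_edges_def entry_edges_def ends_def)
  finally show ?thesis by simp
qed

section \<open>Edges needed to connect an arc or the cycle\<close>

text \<open>The edges used in reaching the sites of a cluster all lie inside it, so it has at least as many open
  inner edges as a spanning tree.\<close>

lemma card_inner_lower:
  assumes "F \<subseteq> {1..N}" "reach N F {i} = A"
  shows "card A \<le> card (F \<inter> inner_edges N A) + 1"
proof -
  have "A \<subseteq> reach N (F \<inter> inner_edges N A) {i}"
    unfolding assms(2)[symmetric]
  proof (rule reach_least)
    fix e assume e: "e \<in> F"
      and "ends N e \<inter> reach N (F \<inter> inner_edges N (reach N F {i})) {i} \<noteq> {}"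
    moreover have "reach N (F \<inter> inner_edges N (reach N F {i})) {i} \<subseteq> reach N F {i}"
      by (intro reach_mono) auto
    ultimately have "ends N e \<subseteq> reach N F {i}"
      using reach_closed[of e F N "{i}"] by blast
    then have "e \<in> F \<inter> inner_edges N (reach N F {i})"
      using e assms(1) by (auto simp: inner_edges_def)
    then show "ends N e \<subseteq> reach N (F \<inter> inner_edges N (reach N F {i})) {i}"
      by (rule reach_closed) fact
  qed (rule subset_reach)
  moreover have "finite (reach N (F \<inter> inner_edges N A) {i}) \<and>
      card (reach N (F \<inter> inner_edges N A) {i}) \<le> card {i} + card (F \<inter> inner_edges N A)"
    by (intro card_reach_le) (auto simp: inner_edges_def)
  ultimately show ?thesis
    using card_mono[of "reach N (F \<inter> inner_edges N A) {i}" A] by simp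
qed

text \<open>A connected set that is not the whole cycle is an arc. Connectedness forces at least \<open>card A - 1\<close>
  inner edges, while the inner edges and the exits together number \<open>card A\<close> and there is at least one
  exit; so there is exactly one exit and, in the same way, one entry. In particular the inner edges
  form a tree.\<close>

lemma connected_proper_cards:
  assumes "connected_sites N A" "A \<noteq> {1..N}"
  shows "card (exit_edges N A) = 1" "card (entry_edges N A) = 1"
    "card (inner_edges N A) = card A - 1"
proof -
  note A = connected_sitesD[OF assms(1)]
  obtain i where i: "i \<in> A" using A by blast
  have "card A \<le> card (inner_edges N A) + 1"
    using card_inner_lower[OF _ A(3)[OF i]] by (simp add: inner_edges_def subset_eq)
  moreover have "finite (exit_edges N A)" "finite (entry_edges N A)"
    by (auto simp: exit_edges_def entry_edges_def)
  then have "card (exit_edges N A) \<noteq> 0" "card (entry_edges N A) \<noteq> 0"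
    using exit_edges_nonempty[OF A(1,2) assms(2)] entry_edges_nonempty[OF A(1,2) assms(2)] by auto
  ultimately show "card (exit_edges N A) = 1" "card (entry_edges N A) = 1"
    "card (inner_edges N A) = card A - 1"
    using card_inner_exit[OF A(1)] card_inner_entry[OF A(1)] by linarith+
qed

lemma connected_proper_boundary:
  assumes "connected_sites N A" "A \<noteq> {1..N}"
  obtains r l where "exit_edges N A = {r}" "entry_edges N A = {l}"
  using connected_proper_cards(1,2)[OF assms] by (auto simp: card_1_singleton_iff)

text \<open>Because the inner edges of an arc form a tree, none of them can be spared: a cluster is the arc
  exactly if all inner edges are open and no boundary edge is.\<close>

lemma reach_eq_proper_iff:
  assumes "connected_sites N A" "A \<noteq> {1..N}" "i \<in> A" "F \<subseteq> {1..N}"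
  shows "reach N F {i} = A \<longleftrightarrow> inner_edges N A \<subseteq> F \<and> F \<inter> edge_boundary N A = {}"
proof
  assume R: "reach N F {i} = A"
  have "card (inner_edges N A) = card A - 1"
    by (rule connected_proper_cards(3)[OF assms(1,2)])
  also have "\<dots> \<le> card (F \<inter> inner_edges N A)"
    using card_inner_lower[OF assms(4) R] by linarith
  finally have "F \<inter> inner_edges N A = inner_edges N A"
    by (intro card_seteq) (auto simp: inner_edges_def)
  moreover have "F \<inter> edge_boundary N A = {}"
    using reach_closed[of _ F N "{i}"] R by (auto simp: edge_boundary_def ends_def)
  ultimately show "inner_edges N A \<subseteq> F \<and> F \<inter> edge_boundary N A = {}" by blast
next
  assume F: "inner_edges N A \<subseteq> F \<and> F \<inter> edge_boundary N A = {}"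
  show "reach N F {i} = A"
  proof (rule reach_eqI)
    show "A \<subseteq> reach N F {i}"
      using connected_sitesD(3)[OF assms(1,3)] reach_mono[of _ F "{i}" "{i}" N] F by blast
    fix e assume "e \<in> F" "ends N e \<inter> A \<noteq> {}"
    moreover have "e \<in> {1..N}" "e \<notin> edge_boundary N A"
      using F assms(4) \<open>e \<in> F\<close> by blast+
    ultimately show "ends N e \<subseteq> A"
      by (auto simp: edge_boundary_def ends_def)
  qed (use assms in auto)
qed

text \<open>The whole cycle contains one edge more than a spanning tree, hence it tolerates one closed edge.
  Two closed edges always disconnect it; conversely, a cluster other than the whole cycle has an
  exit and an entry, and both of them are closed.\<close>

lemma reach_eq_ring_iff:
  assumes "i \<in> {1..N}" "F \<subseteq> {1..N}"
  shows "reach N F {i} = {1..N} \<longleftrightarrow> N \<le> card F + 1"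
proof
  assume R: "reach N F {i} = {1..N}"
  then show "N \<le> card F + 1"
    using card_reach_le[of F "{i}" N] assms(2) finite_subset[of F "{1..N}"] by auto
next
  assume F: "N \<le> card F + 1"
  let ?R = "reach N F {i}"
  have sub: "?R \<subseteq> {1..N}" using assms by (intro reach_subset) auto
  have ne: "?R \<noteq> {}" using subset_reach[of "{i}" N F] by blast
  show "?R = {1..N}"
  proof (rule ccontr)
    assume ring: "?R \<noteq> {1..N}"
    \<comment> \<open>The cluster would have two distinct closed boundary edges, but at most one edge is closed.\<close>
    obtain r l where rl: "r \<in> exit_edges N ?R" "l \<in> entry_edges N ?R"
      using exit_edges_nonempty[OF sub ne ring] entry_edges_nonempty[OF sub ne ring] by blast
    then have "r \<noteq> l" "r \<in> {1..N}" "l \<in> {1..N}" "r \<notin> F" "l \<notin> F"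
      using reach_closed[of _ F N "{i}"] by (auto simp: exit_edges_def entry_edges_def ends_def)
    then have "card (insert r (insert l F)) = card F + 2" "insert r (insert l F) \<subseteq> {1..N}"
      using assms(2) finite_subset[OF assms(2)] by auto
    then show False
      using F card_mono[of "{1..N}" "insert r (insert l F)"] by auto
  qed
qed

section \<open>Bond percolation\<close>

text \<open>The probability of the event \<open>Q\<close> about the random set of open edges when each edge of \<open>E\<close> is open
  with probability \<open>p\<close>, independently. It is written as a finite sum because the argument only needs
  the effect of conditioning on a single edge.\<close>

definition perc_prob :: "real \<Rightarrow> 'a set \<Rightarrow> ('a set \<Rightarrow> bool) \<Rightarrow> real" where
  "perc_prob p E Q = (\<Sum>F\<in>Pow E. p ^ card F * (1 - p) ^ card (E - F) * of_bool (Q F))"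

lemma perc_prob_cong:
  assumes "\<And>F. F \<subseteq> E \<Longrightarrow> Q F \<longleftrightarrow> Q' F"
  shows "perc_prob p E Q = perc_prob p E Q'"
  unfolding perc_prob_def using assms by (intro sum.cong) auto

lemma perc_prob_empty [simp]: "perc_prob p {} Q = of_bool (Q {})"
  by (simp add: perc_prob_def)

lemma perc_prob_False [simp]: "perc_prob p E (\<lambda>F. False) = 0"
  by (simp add: perc_prob_def)

lemma perc_prob_insert:
  assumes "finite E" "e \<notin> E"
  shows "perc_prob p (insert e E) Q =
    p * perc_prob p E (\<lambda>F. Q (insert e F)) + (1 - p) * perc_prob p E Q"
proof -
  let ?w = "\<lambda>F. p ^ card F * (1 - p) ^ card (insert e E - F) * of_bool (Q F)"
  have "perc_prob p (insert e E) Q = sum ?w (Pow E) + sum ?w (insert e ` Pow E)"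
    unfolding perc_prob_def Pow_insert using assms
    by (intro sum.union_disjoint) auto
  moreover have "sum ?w (insert e ` Pow E) = (\<Sum>F\<in>Pow E. ?w (insert e F))"
    using assms(2) by (intro sum.reindex_cong[of "insert e"]) (auto simp: inj_on_def)
  moreover have "(\<Sum>F\<in>Pow E. ?w (insert e F)) = p * perc_prob p E (\<lambda>F. Q (insert e F))"
    unfolding perc_prob_def sum_distrib_left
  proof (intro sum.cong refl)
    fix F assume "F \<in> Pow E"
    then have "card (insert e F) = card F + 1" "insert e E - insert e F = E - F"
      using assms finite_subset[of F E] by (auto simp: card_insert_if)
    then show "?w (insert e F) =
        p * (p ^ card F * (1 - p) ^ card (E - F) * of_bool (Q (insert e F)))"
      by simp
  qed
  moreover have "sum ?w (Pow E) = (1 - p) * perc_prob p E Q"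
    unfolding perc_prob_def sum_distrib_left
  proof (intro sum.cong refl)
    fix F assume "F \<in> Pow E"
    then have "insert e E - F = insert e (E - F)"
      using assms(2) by auto
    then have "card (insert e E - F) = card (E - F) + 1"
      using assms by simp
    then show "?w F = (1 - p) * (p ^ card F * (1 - p) ^ card (E - F) * of_bool (Q F))"
      by simp
  qed
  ultimately show ?thesis by simp
qed

text \<open>Prescribing the states of some edges has the product of their probabilities: conditioning on one
  edge of \<open>E\<close> after the other contributes a factor \<open>p\<close>, a factor \<open>1 - p\<close>, or, for an edge without
  prescription, \<open>p + (1 - p) = 1\<close>.\<close>

lemma perc_prob_cylinder:
  assumes "finite E" "I \<subseteq> E" "B \<subseteq> E" "I \<inter> B = {}"
  shows "perc_prob p E (\<lambda>F. I \<subseteq> F \<and> F \<inter> B = {}) = p ^ card I * (1 - p) ^ card B"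
  using assms
proof (induction E arbitrary: I B rule: finite_induct)
  case (insert e E)
  note fin = finite_subset[OF insert.prems(1)] finite_subset[OF insert.prems(2)]
  have fin: "finite I" "finite B" using fin insert.hyps by simp_all
  consider (inner) "e \<in> I" "e \<notin> B" | (boundary) "e \<in> B" "e \<notin> I" | (neither) "e \<notin> I" "e \<notin> B"
    using insert.prems by blast
  then show ?case
  proof cases
    case inner
    have "perc_prob p E (\<lambda>F. I \<subseteq> insert e F \<and> insert e F \<inter> B = {}) =
        perc_prob p E (\<lambda>F. I - {e} \<subseteq> F \<and> F \<inter> B = {})"
      using inner by (intro perc_prob_cong) auto
    also have "\<dots> = p ^ card (I - {e}) * (1 - p) ^ card B"
      using insert.prems inner by (intro insert.IH) auto
    moreover have "perc_prob p E (\<lambda>F. I \<subseteq> F \<and> F \<inter> B = {}) = perc_prob p E (\<lambda>F. False)"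
      using inner insert.hyps by (intro perc_prob_cong) auto
    moreover have "card I = card (I - {e}) + 1"
      using inner fin by (metis Suc_eq_plus1 card_Suc_Diff1)
    ultimately show ?thesis
      using insert.hyps by (simp add: perc_prob_insert)
  next
    case boundary
    have "perc_prob p E (\<lambda>F. I \<subseteq> F \<and> F \<inter> B = {}) =
        perc_prob p E (\<lambda>F. I \<subseteq> F \<and> F \<inter> (B - {e}) = {})"
      using insert.hyps by (intro perc_prob_cong) auto
    also have "\<dots> = p ^ card I * (1 - p) ^ card (B - {e})"
      using insert.prems boundary by (intro insert.IH) auto
    moreover have "perc_prob p E (\<lambda>F. I \<subseteq> insert e F \<and> insert e F \<inter> B = {}) =
        perc_prob p E (\<lambda>F. False)"
      using boundary by (intro perc_prob_cong) auto
    moreover have "card B = card (B - {e}) + 1"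
      using boundary fin by (metis Suc_eq_plus1 card_Suc_Diff1)
    ultimately show ?thesis
      using insert.hyps by (simp add: perc_prob_insert)
  next
    case neither
    have "perc_prob p E (\<lambda>F. I \<subseteq> insert e F \<and> insert e F \<inter> B = {}) =
        perc_prob p E (\<lambda>F. I \<subseteq> F \<and> F \<inter> B = {})"
      using neither by (intro perc_prob_cong) auto
    moreover have "perc_prob p E (\<lambda>F. I \<subseteq> F \<and> F \<inter> B = {}) = p ^ card I * (1 - p) ^ card B"
      using insert.prems neither by (intro insert.IH) auto
    ultimately show ?thesis
      using insert.hyps by (simp add: perc_prob_insert algebra_simps)
  qed
qed auto

lemma perc_prob_const:
  assumes "finite E"
  shows "perc_prob p E (\<lambda>F. b) = of_bool b"
  using perc_prob_cylinder[OF assms, of "{}" "{}" p] by (cases b) simp_all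

lemma perc_prob_at_most_one_missing:
  assumes "finite E"
  shows "perc_prob p E (\<lambda>F. card E \<le> card F + 1) =
    p ^ card E + real (card E) * p ^ (card E - 1) * (1 - p)"
  using assms
proof (induction E rule: finite_induct)
  case (insert e E)
  have "perc_prob p E (\<lambda>F. card (insert e E) \<le> card (insert e F) + 1) =
      perc_prob p E (\<lambda>F. card E \<le> card F + 1)"
    using insert.hyps finite_subset[of _ E] by (intro perc_prob_cong) (auto simp: card_insert_if)
  \<comment> \<open>If \<open>e\<close> is closed, all other edges must be open.\<close>
  moreover have "perc_prob p E (\<lambda>F. card (insert e E) \<le> card F + 1) =
      perc_prob p E (\<lambda>F. E \<subseteq> F \<and> F \<inter> {} = {})"
    using insert.hyps card_seteq[of E] card_mono[of _ E] finite_subset[of _ E]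
    by (intro perc_prob_cong) auto
  moreover have "\<dots> = p ^ card E"
    using insert.hyps by (subst perc_prob_cylinder) auto
  ultimately show ?case
    using insert.hyps insert.IH
    by (cases "card E") (simp_all add: perc_prob_insert, simp add: algebra_simps)
qed simp

section \<open>Cluster growth as percolation\<close>

lemma configs_spin: "\<sigma> \<in> configs N \<Longrightarrow> i \<in> {1..N} \<Longrightarrow> \<sigma> i = 1 \<or> \<sigma> i = - 1"
  by (auto simp: configs_def PiE_def Pi_def)

lemma B_plus_eq:
  assumes "\<sigma> \<in> configs N"
  shows "B_plus N \<sigma> = {e \<in> {1..N}. \<sigma> e = \<sigma> (nxt N e)}"
proof -
  have "\<sigma> e * \<sigma> (nxt N e) = 1 \<longleftrightarrow> \<sigma> e = \<sigma> (nxt N e)" if "e \<in> {1..N}" for e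
    using configs_spin[OF assms that] configs_spin[OF assms nxt_in[OF that]] by auto
  then show ?thesis by (auto simp: B_plus_def)
qed

lemma frontier_edges_eq:
  assumes "\<sigma> \<in> configs N"
  shows "frontier_edges N \<sigma> C S = {e \<in> B_plus N \<sigma> - S. ends N e \<inter> C \<noteq> {}}"
  by (auto simp: frontier_edges_def B_plus_eq[OF assms])

lemma kappa_bounds: "0 \<le> J \<Longrightarrow> 0 \<le> kappa J" "kappa J \<le> 1"
  by (auto simp: kappa_def)

lemma one_minus_kappa: "1 - kappa J = kappa_hat J"
  by (simp add: kappa_def kappa_hat_def)

text \<open>The order in which the growth procedure considers the edges does not matter. It reveals the state
  of an edge when the edge is first touched by the cluster, and the edges that are never touched have no
  influence on the cluster. Therefore the final cluster is distributed as the open component in an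
  independent percolation on all aligned edges. The proof conditions the percolation on the edge
  that the procedure considers next; the set reached from the cluster changes according to
  the exploration step, and the remaining edges are again independent.\<close>

lemma pmf_grow_cluster:
  assumes "0 \<le> J" "\<sigma> \<in> configs N"
  shows "pmf (grow_cluster N J \<sigma> C S) A =
    perc_prob (kappa J) (B_plus N \<sigma> - S) (\<lambda>F. reach N F C = A)"
proof (induction "card (B_plus N \<sigma> - S)" arbitrary: C S rule: less_induct)
  case less
  let ?E = "B_plus N \<sigma> - S" and ?fr = "frontier_edges N \<sigma> C S"
  note fr = frontier_edges_eq[OF assms(2)]
  have fin: "finite ?E" by (simp add: B_plus_def)
  show ?case
  proof (cases "?fr = {}")
    case True
    then have "perc_prob (kappa J) ?E (\<lambda>F. reach N F C = A) = perc_prob (kappa J) ?E (\<lambda>F. C = A)"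
      by (intro perc_prob_cong) (subst reach_untouched, auto simp: fr)
    then show ?thesis
      using True fin by (subst grow_cluster.simps) (simp add: perc_prob_const)
  next
    case False
    define e where "e = (SOME e. e \<in> ?fr)"
    have "e \<in> ?fr"
      using False unfolding e_def by (simp add: some_in_eq)
    then have e: "e \<in> ?E" "ends N e \<inter> C \<noteq> {}" "e \<in> B_plus N \<sigma>"
      by (auto simp: fr)
    \<comment> \<open>Conditioning on the state of the edge that the procedure considers next.\<close>
    have E: "?E = insert e (B_plus N \<sigma> - insert e S)" using e(1) by blast
    have "card (B_plus N \<sigma> - insert e S) < card ?E"
      using fin e(1) by (intro psubset_card_mono) auto
    note IH = less.hyps[OF this]
    have "1 - exp (- J * (1 + \<sigma> e * \<sigma> (nxt N e))) = kappa J"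
      using e(3) by (simp add: B_plus_def kappa_def algebra_simps)
    then have "pmf (grow_cluster N J \<sigma> C S) A =
        kappa J * pmf (grow_cluster N J \<sigma> (C \<union> ends N e) (insert e S)) A +
        (1 - kappa J) * pmf (grow_cluster N J \<sigma> C (insert e S)) A"
      using False kappa_bounds[of J] assms(1)
      by (subst grow_cluster.simps)
         (simp add: Let_def e_def[symmetric] pmf_bind del: exp_le_one_iff)
    also have "\<dots> = kappa J * perc_prob (kappa J) (B_plus N \<sigma> - insert e S)
          (\<lambda>F. reach N (insert e F) C = A) +
        (1 - kappa J) * perc_prob (kappa J) (B_plus N \<sigma> - insert e S) (\<lambda>F. reach N F C = A)"
    proof -
      have "reach N F (C \<union> ends N e) = reach N (insert e F) C"
        if "F \<subseteq> B_plus N \<sigma> - insert e S" for F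
      proof -
        have "insert e F - {e} = F" using that by blast
        then show ?thesis using reach_explore[of e "insert e F" N C] e(2) by simp
      qed
      then have "perc_prob (kappa J) (B_plus N \<sigma> - insert e S) (\<lambda>F. reach N F (C \<union> ends N e) = A) =
          perc_prob (kappa J) (B_plus N \<sigma> - insert e S) (\<lambda>F. reach N (insert e F) C = A)"
        by (intro perc_prob_cong) simp
      then show ?thesis by (simp add: IH)
    qed
    also have "\<dots> = perc_prob (kappa J) ?E (\<lambda>F. reach N F C = A)"
      unfolding E using fin by (subst perc_prob_insert) (auto simp: B_plus_def)
    finally show ?thesis .
  qed
qed

section \<open>The transition kernel\<close>

definition spin_class :: "nat \<Rightarrow> (nat \<Rightarrow> real) \<Rightarrow> real \<Rightarrow> nat set" where
  "spin_class N \<sigma> s = {k \<in> {1..N}. \<sigma> k = s}"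

lemma aligned_iff:
  assumes "\<sigma> \<in> configs N" "A \<subseteq> {1..N}" "i \<in> A"
  shows "aligned \<sigma> A \<longleftrightarrow> A \<subseteq> spin_class N \<sigma> (\<sigma> i)"
proof -
  have spin: "\<sigma> j = 1 \<or> \<sigma> j = - 1" if "j \<in> A" for j
    using configs_spin[OF assms(1), of j] that assms(2) by blast
  show ?thesis
  proof
    assume al: "aligned \<sigma> A"
    show "A \<subseteq> spin_class N \<sigma> (\<sigma> i)"
    proof
      fix j assume "j \<in> A"
      moreover from this have "\<sigma> j * \<sigma> i = 1"
        using al assms(3) by (auto simp: aligned_def)
      ultimately show "j \<in> spin_class N \<sigma> (\<sigma> i)"
        using spin[of j] spin[OF assms(3)] assms(2) by (auto simp: spin_class_def)
    qed
  next
    assume A: "A \<subseteq> spin_class N \<sigma> (\<sigma> i)"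
    show "aligned \<sigma> A"
      unfolding aligned_def
    proof (intro ballI)
      fix j k assume "j \<in> A" "k \<in> A"
      then have "\<sigma> j = \<sigma> i" "\<sigma> k = \<sigma> i" using A by (auto simp: spin_class_def)
      then show "\<sigma> j * \<sigma> k = 1" using spin[OF assms(3)] by auto
    qed
  qed
qed

lemma flip_eq_iff:
  assumes "\<sigma> \<in> configs N" "A \<subseteq> {1..N}" "B \<subseteq> {1..N}"
  shows "flip A \<sigma> = flip B \<sigma> \<longleftrightarrow> A = B"
proof
  assume eq: "flip A \<sigma> = flip B \<sigma>"
  have "i \<in> A \<longleftrightarrow> i \<in> B" if "i \<in> {1..N}" for i
    using fun_cong[OF eq, of i] configs_spin[OF assms(1) that]
    by (auto simp: flip_def split: if_splits)
  then show "A = B" using assms by blast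
qed simp

lemma flip_flip: "flip A (flip A \<sigma>) = \<sigma>"
  by (auto simp: flip_def)

lemma flip_in_configs:
  assumes "\<sigma> \<in> configs N" "A \<subseteq> {1..N}"
  shows "flip A \<sigma> \<in> configs N"
  unfolding configs_def
proof (rule PiE_I)
  show "flip A \<sigma> i \<in> {- 1, 1}" if "i \<in> {1..N}" for i
    using configs_spin[OF assms(1) that] by (auto simp: flip_def)
  show "flip A \<sigma> i = undefined" if "i \<notin> {1..N}" for i
    using assms that by (auto simp: flip_def configs_def PiE_def extensional_def)
qed

lemma configs_flip_differences:
  assumes "\<sigma> \<in> configs N" "\<eta> \<in> configs N"
  shows "\<eta> = flip {i \<in> {1..N}. \<eta> i \<noteq> \<sigma> i} \<sigma>"
proof
  fix i
  show "\<eta> i = flip {i \<in> {1..N}. \<eta> i \<noteq> \<sigma> i} \<sigma> i"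
  proof (cases "i \<in> {1..N}")
    case True
    then show ?thesis
      using configs_spin[OF assms(1) True] configs_spin[OF assms(2) True] by (auto simp: flip_def)
  next
    case False
    then show ?thesis
      using assms by (auto simp: flip_def configs_def PiE_def extensional_def)
  qed
qed

lemma percolation_cluster_aligned:
  assumes "\<sigma> \<in> configs N" "F \<subseteq> B_plus N \<sigma>" "i \<in> {1..N}"
  shows "aligned \<sigma> (reach N F {i})"
proof -
  have F: "F \<subseteq> {1..N}" using assms(2) by (auto simp: B_plus_def)
  have "reach N F {i} \<subseteq> spin_class N \<sigma> (\<sigma> i)"
  proof (rule reach_least)
    fix e assume e: "e \<in> F" "ends N e \<inter> spin_class N \<sigma> (\<sigma> i) \<noteq> {}"
    then have "\<sigma> e = \<sigma> (nxt N e)"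
      using assms(2) B_plus_eq[OF assms(1)] by blast
    moreover have "ends N e \<subseteq> {1..N}"
      using e(1) F ends_subset by blast
    ultimately show "ends N e \<subseteq> spin_class N \<sigma> (\<sigma> i)"
      using e(2) by (auto simp: ends_def spin_class_def)
  qed (use assms(3) in \<open>simp add: spin_class_def\<close>)
  then show ?thesis
    using aligned_iff[OF assms(1), of "reach N F {i}" i] reach_subset[OF F, of "{i}"] assms(3)
      subset_reach[of "{i}" N F] by simp
qed

lemma pmf_grow_cluster_eq_0:
  assumes "0 \<le> J" "\<sigma> \<in> configs N" "i \<in> {1..N}"
    "\<not> (connected_sites N A \<and> aligned \<sigma> A \<and> i \<in> A)"
  shows "pmf (grow_cluster N J \<sigma> {i} {}) A = 0"
proof -
  have "reach N F {i} \<noteq> A" if "F \<subseteq> B_plus N \<sigma>" for F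
  proof
    assume R: "reach N F {i} = A"
    have "F \<subseteq> {1..N}" using that by (auto simp: B_plus_def)
    then show False
      using connected_sites_reach[of F N i] percolation_cluster_aligned[OF assms(2) that assms(3)]
        subset_reach[of "{i}" N F] assms(3,4) R by blast
  qed
  then have "perc_prob (kappa J) (B_plus N \<sigma>) (\<lambda>F. reach N F {i} = A) =
      perc_prob (kappa J) (B_plus N \<sigma>) (\<lambda>F. False)"
    by (intro perc_prob_cong) simp
  then show ?thesis
    using pmf_grow_cluster[OF assms(1,2), of "{i}" "{}" A] by simp
qed

text \<open>Distinct sets of sites lead to distinct flipped configurations, so the new configuration determines
  the cluster.\<close>

lemma P_W_flip:
  assumes "1 \<le> N" "0 \<le> J" "\<sigma> \<in> configs N" "A \<subseteq> {1..N}"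
  shows "P_W N J \<sigma> (flip A \<sigma>) =
    (\<Sum>i = 1..N. pmf (grow_cluster N J \<sigma> {i} {}) A) / real N"
proof -
  have "pmf (grow_cluster N J \<sigma> {i} {} \<bind> (\<lambda>C. return_pmf (flip C \<sigma>))) (flip A \<sigma>) =
      pmf (grow_cluster N J \<sigma> {i} {}) A" if i: "i \<in> {1..N}" for i
  proof -
    let ?p = "grow_cluster N J \<sigma> {i} {}"
    have "C \<subseteq> {1..N}" if "C \<in> set_pmf ?p" for C
      using pmf_grow_cluster_eq_0[OF assms(2,3) i, of C] that connected_sitesD(1)[of N C]
      by (auto simp: set_pmf_iff)
    then have "(\<lambda>C. flip C \<sigma>) -` {flip A \<sigma>} \<inter> set_pmf ?p = {A} \<inter> set_pmf ?p"
      using flip_eq_iff[OF assms(3) _ assms(4)] by auto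
    then have "measure ?p ((\<lambda>C. flip C \<sigma>) -` {flip A \<sigma>}) = measure ?p {A}"
      by (metis measure_Int_set_pmf)
    then show ?thesis
      by (simp add: map_pmf_def[symmetric] pmf_map measure_pmf_single)
  qed
  then show ?thesis
    using assms(1) unfolding P_W_def wolff_def
    by (subst pmf_bind_pmf_of_set) simp_all
qed

text \<open>The probability that the inner edges connect a set of \<open>n\<close> aligned sites, namely of an arc if
  \<open>n < N\<close> and of the whole cycle, where one edge may be closed, if \<open>n = N\<close>.\<close>

definition cluster_weight :: "nat \<Rightarrow> real \<Rightarrow> nat \<Rightarrow> real" where
  "cluster_weight N J n =
    (if n = N then (real N * kappa_hat J + kappa J) * kappa J ^ (N - 1) else kappa J ^ (n - 1))"

lemma card_eq_ring_iff: "A \<subseteq> {1..N} \<Longrightarrow> card A = N \<longleftrightarrow> A = {1..N}"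
  using card_subset_eq[of "{1..N}" A] by auto

lemma edge_boundary_ring: "edge_boundary N {1..N} = {}"
  using nxt_in[of _ N] by (auto simp: edge_boundary_def)

lemma pmf_grow_cluster_connected:
  assumes "1 \<le> N" "0 \<le> J" "\<sigma> \<in> configs N" "connected_sites N A" "aligned \<sigma> A" "i \<in> A"
  shows "pmf (grow_cluster N J \<sigma> {i} {}) A =
    cluster_weight N J (card A) * kappa_hat J ^ card (edge_boundary N A \<inter> B_plus N \<sigma>)"
proof -
  let ?E = "B_plus N \<sigma>"
  have sub: "A \<subseteq> {1..N}" by (rule connected_sitesD(1)[OF assms(4)])
  have E: "?E \<subseteq> {1..N}" "finite ?E" by (auto simp: B_plus_def)
  have inner: "inner_edges N A \<subseteq> ?E"
    using assms(5) by (auto simp: inner_edges_def B_plus_def aligned_def ends_def)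
  have pmf: "pmf (grow_cluster N J \<sigma> {i} {}) A = perc_prob (kappa J) ?E (\<lambda>F. reach N F {i} = A)"
    using pmf_grow_cluster[OF assms(2,3), of "{i}" "{}" A] by simp
  show ?thesis
  proof (cases "A = {1..N}")
    case True
    then have "?E = {1..N}"
      using inner E ends_subset[of _ N] by (auto simp: inner_edges_def simp del: atLeastAtMost_iff)
    then have "perc_prob (kappa J) ?E (\<lambda>F. reach N F {i} = A) =
        perc_prob (kappa J) {1..N} (\<lambda>F. card {1..N} \<le> card F + 1)"
      using reach_eq_ring_iff[of i N] sub assms(6) True
      by (simp only:) (intro perc_prob_cong, auto)
    also have "\<dots> = kappa J ^ N + real N * kappa J ^ (N - 1) * kappa_hat J"
      by (subst perc_prob_at_most_one_missing) (simp_all add: one_minus_kappa)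
    also have "\<dots> = (real N * kappa_hat J + kappa J) * kappa J ^ (N - 1)"
      using assms(1) by (cases N) (auto simp: algebra_simps)
    finally have "perc_prob (kappa J) ?E (\<lambda>F. reach N F {i} = A) = cluster_weight N J (card A)"
      using True by (simp add: cluster_weight_def)
    moreover have "edge_boundary N A = {}"
      unfolding True by (rule edge_boundary_ring)
    ultimately show ?thesis
      by (simp add: pmf)
  next
    case False
    have "perc_prob (kappa J) ?E (\<lambda>F. reach N F {i} = A) =
        perc_prob (kappa J) ?E (\<lambda>F. inner_edges N A \<subseteq> F \<and> F \<inter> (edge_boundary N A \<inter> ?E) = {})"
      using reach_eq_proper_iff[OF assms(4) False assms(6)] E by (intro perc_prob_cong) auto
    also have "\<dots> = kappa J ^ card (inner_edges N A) * kappa_hat J ^ card (edge_boundary N A \<inter> ?E)"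
      using inner E unfolding one_minus_kappa[symmetric]
      by (intro perc_prob_cylinder) (auto simp: inner_edges_def edge_boundary_def ends_def)
    also have "card (inner_edges N A) = card A - 1"
      by (rule connected_proper_cards(3)[OF assms(4) False])
    finally show ?thesis
      using False sub unfolding pmf by (simp add: cluster_weight_def card_eq_ring_iff)
  qed
qed

text \<open>The cluster is \<open>A\<close> only if it starts at a site of \<open>A\<close>, whence the factor \<open>card A / N\<close>. Given this,
  the inner edges must connect \<open>A\<close> and the aligned boundary edges must be closed; the boundary
  edges with opposite spins are closed anyway.\<close>

lemma wolff_kernel:
  assumes "1 \<le> N" "0 \<le> J" "\<sigma> \<in> configs N" "connected_sites N A" "aligned \<sigma> A"
  shows "P_W N J \<sigma> (flip A \<sigma>) = real (card A) / real N *
    (cluster_weight N J (card A) * kappa_hat J ^ card (edge_boundary N A \<inter> B_plus N \<sigma>))"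
proof -
  let ?w = "cluster_weight N J (card A) * kappa_hat J ^ card (edge_boundary N A \<inter> B_plus N \<sigma>)"
  have sub: "A \<subseteq> {1..N}" by (rule connected_sitesD(1)[OF assms(4)])
  have "(\<Sum>i = 1..N. pmf (grow_cluster N J \<sigma> {i} {}) A) = (\<Sum>i\<in>A. ?w)"
    using sub pmf_grow_cluster_connected[OF assms] pmf_grow_cluster_eq_0[OF assms(2,3)]
    by (intro sum.mono_neutral_cong_right) auto
  then show ?thesis
    using P_W_flip[OF assms(1-3) sub] by simp
qed

lemma wolff_kernel_eq_0:
  assumes "1 \<le> N" "0 \<le> J" "\<sigma> \<in> configs N" "A \<subseteq> {1..N}"
    "\<not> connected_sites N A \<or> \<not> aligned \<sigma> A"
  shows "P_W N J \<sigma> (flip A \<sigma>) = 0"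
proof -
  have "(\<Sum>i = 1..N. pmf (grow_cluster N J \<sigma> {i} {}) A) = 0"
    using pmf_grow_cluster_eq_0[OF assms(2,3)] assms(5) by (intro sum.neutral) blast
  then show ?thesis using P_W_flip[OF assms(1-4)] by simp
qed

section \<open>Detailed balance\<close>

text \<open>With \<open>b\<close> aligned edges in a boundary of \<open>m\<close> edges, the boundary contributes \<open>2 * b - m\<close> to the
  sum of the products of neighbouring spins. The factor \<open>exp (- 2 * J * b)\<close> from closing the aligned
  boundary edges cancels the part that depends on \<open>b\<close>. What is left is the same before and after
  the flip of \<open>A\<close>, which is the reason for detailed balance.\<close>

lemma gibbs_weight_boundary:
  assumes "\<sigma> \<in> configs N"
  shows "gibbs_weight N J \<sigma> * kappa_hat J ^ card (edge_boundary N A \<inter> B_plus N \<sigma>) =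
    exp (J * ((\<Sum>e\<in>{1..N} - edge_boundary N A. \<sigma> e * \<sigma> (nxt N e))
      - real (card (edge_boundary N A))))"
proof -
  let ?D = "edge_boundary N A" and ?s = "\<lambda>e. \<sigma> e * \<sigma> (nxt N e)"
  have D: "?D \<subseteq> {1..N}" "finite ?D" by (auto simp: edge_boundary_def)
  have pm: "?s e = 2 * of_bool (e \<in> B_plus N \<sigma>) - 1" if "e \<in> {1..N}" for e
    using configs_spin[OF assms that] configs_spin[OF assms nxt_in[OF that]] that
    by (auto simp: B_plus_def)
  have "sum ?s ?D = (\<Sum>e\<in>?D. 2 * of_bool (e \<in> B_plus N \<sigma>) - 1)"
    using pm D by (intro sum.cong) auto
  also have "\<dots> = 2 * real (card (?D \<inter> B_plus N \<sigma>)) - real (card ?D)"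
    using D by (simp add: sum_subtractf sum_distrib_left[symmetric] sum_of_bool_eq Int_def)
  finally have total: "sum ?s {1..N} =
      sum ?s ({1..N} - ?D) + (2 * real (card (?D \<inter> B_plus N \<sigma>)) - real (card ?D))"
    using sum.subset_diff[OF D(1), of ?s] by simp
  show ?thesis
    unfolding gibbs_weight_def kappa_hat_def total exp_of_nat_mult[symmetric] exp_add[symmetric]
    by (simp add: algebra_simps)
qed

text \<open>The moves from \<open>\<sigma>\<close> and back flip the same set \<open>A\<close>, so the two transition probabilities differ
  only in the number of aligned boundary edges.\<close>

lemma detailed_balance_flip:
  assumes "1 \<le> N" "0 \<le> J" "\<sigma> \<in> configs N" "A \<subseteq> {1..N}"
  shows "gibbs N J (flip A \<sigma>) * P_W N J (flip A \<sigma>) \<sigma> = gibbs N J \<sigma> * P_W N J \<sigma> (flip A \<sigma>)"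
proof -
  let ?\<eta> = "flip A \<sigma>"
  have \<eta>: "?\<eta> \<in> configs N" using flip_in_configs[OF assms(3,4)] .
  have al: "aligned ?\<eta> A \<longleftrightarrow> aligned \<sigma> A"
    by (simp add: aligned_def flip_def)
  show ?thesis
  proof (cases "connected_sites N A \<and> aligned \<sigma> A")
    case True
    let ?b = "\<lambda>\<tau>. card (edge_boundary N A \<inter> B_plus N \<tau>)"
    have "(\<Sum>e\<in>{1..N} - edge_boundary N A. ?\<eta> e * ?\<eta> (nxt N e)) =
        (\<Sum>e\<in>{1..N} - edge_boundary N A. \<sigma> e * \<sigma> (nxt N e))"
      by (intro sum.cong) (auto simp: edge_boundary_def flip_def)
    then have "gibbs_weight N J ?\<eta> * kappa_hat J ^ ?b ?\<eta> = gibbs_weight N J \<sigma> * kappa_hat J ^ ?b \<sigma>"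
      by (simp add: gibbs_weight_boundary[OF \<eta>] gibbs_weight_boundary[OF assms(3)])
    moreover have "P_W N J ?\<eta> \<sigma> = real (card A) / real N *
        (cluster_weight N J (card A) * kappa_hat J ^ ?b ?\<eta>)"
      using wolff_kernel[OF assms(1,2) \<eta>, of A] True al by (simp add: flip_flip)
    moreover have "P_W N J \<sigma> ?\<eta> = real (card A) / real N *
        (cluster_weight N J (card A) * kappa_hat J ^ ?b \<sigma>)"
      using wolff_kernel[OF assms(1,2,3), of A] True by simp
    ultimately show ?thesis
      by (simp add: gibbs_def mult.left_commute mult.commute)
  next
    case False
    then show ?thesis
      using wolff_kernel_eq_0[OF assms] wolff_kernel_eq_0[OF assms(1,2) \<eta> assms(4)] al
      by (auto simp: flip_flip)
  qed
qed

lemma wolff_detailed_balance: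
  assumes "1 \<le> N" "0 \<le> J" "\<eta> \<in> configs N" "\<sigma> \<in> configs N"
  shows "gibbs N J \<eta> * P_W N J \<eta> \<sigma> = gibbs N J \<sigma> * P_W N J \<sigma> \<eta>"
proof -
  let ?A = "{i \<in> {1..N}. \<eta> i \<noteq> \<sigma> i}"
  have "?A \<subseteq> {1..N}" by blast
  from detailed_balance_flip[OF assms(1,2,4) this] show ?thesis
    unfolding configs_flip_differences[OF assms(4,3), symmetric] .
qed

section \<open>Zero coupling\<close>

lemma grow_cluster_zero_coupling: "grow_cluster N 0 \<sigma> C S = return_pmf C"
proof (induction N "0 :: real" \<sigma> C S rule: grow_cluster.induct)
  case (1 N \<sigma> C S)
  have "bernoulli_pmf 0 = return_pmf False"
    by (rule pmf_eqI) (simp split: split_indicator)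
  with 1 show ?case
    by (subst grow_cluster.simps) (auto simp: Let_def bind_return_pmf)
qed

lemma hypercube_neighbours_eq:
  assumes "\<sigma> \<in> configs N"
  shows "hypercube_neighbours N \<sigma> = (\<lambda>i. flip {i} \<sigma>) ` {1..N}"
proof (intro equalityI subsetI)
  fix \<eta> assume "\<eta> \<in> hypercube_neighbours N \<sigma>"
  then obtain i where i: "\<eta> \<in> configs N" "{i \<in> {1..N}. \<eta> i \<noteq> \<sigma> i} = {i}"
    by (auto simp: hypercube_neighbours_def card_1_singleton_iff)
  then have "\<eta> = flip {i} \<sigma>" using configs_flip_differences[OF assms, of \<eta>] by simp
  then show "\<eta> \<in> (\<lambda>i. flip {i} \<sigma>) ` {1..N}" using i(2) by blast
next
  fix \<eta> assume "\<eta> \<in> (\<lambda>i. flip {i} \<sigma>) ` {1..N}"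
  then obtain i where i: "i \<in> {1..N}" "\<eta> = flip {i} \<sigma>" by blast
  then have "{j \<in> {1..N}. \<eta> j \<noteq> \<sigma> j} = {i}"
    using configs_spin[OF assms i(1)] by (auto simp: flip_def)
  then show "\<eta> \<in> hypercube_neighbours N \<sigma>"
    using flip_in_configs[OF assms, of "{i}"] i by (simp add: hypercube_neighbours_def)
qed

lemma wolff_zero_coupling:
  assumes "1 \<le> N" "\<sigma> \<in> configs N"
  shows "wolff N 0 \<sigma> = hypercube_srw N \<sigma>"
proof -
  have "inj_on (\<lambda>i. flip {i} \<sigma>) {1..N}"
    using flip_eq_iff[OF assms(2), of "{_}" "{_}"] by (auto simp: inj_on_def)
  then show ?thesis
    using assms map_pmf_of_set_inj[of "\<lambda>i. flip {i} \<sigma>" "{1..N}"]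
    by (simp add: wolff_def grow_cluster_zero_coupling bind_return_pmf hypercube_srw_def
        hypercube_neighbours_eq map_pmf_def)
qed

lemma P_W_zero_coupling:
  assumes "1 \<le> N" "\<sigma> \<in> configs N" "A \<subseteq> {1..N}"
  shows "P_W N 0 \<sigma> (flip A \<sigma>) = real (card {i \<in> {1..N}. {i} = A}) / real N"
  using P_W_flip[OF assms(1) _ assms(2,3), of 0]
  by (simp add: grow_cluster_zero_coupling indicator_def sum.If_cases Int_def)

section \<open>Components of equal spin\<close>

lemma finite_cycle_components: "V \<subseteq> {1..N} \<Longrightarrow> finite (cycle_components N V)"
  by (rule finite_subset[of _ "Pow {1..N}"]) (auto simp: cycle_components_def)

lemma component_exists:
  assumes "connected_sites N A" "A \<subseteq> V" "V \<subseteq> {1..N}"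
  obtains K where "K \<in> cycle_components N V" "A \<subseteq> K"
proof -
  let ?S = "{K. K \<subseteq> V \<and> connected_sites N K}"
  have "finite ?S"
    using assms(3) by (intro finite_subset[of ?S "Pow {1..N}"]) auto
  moreover have "A \<in> ?S" using assms by simp
  ultimately obtain K where "K \<in> ?S" "A \<subseteq> K" "\<forall>K'\<in>?S. K \<subseteq> K' \<longrightarrow> K = K'"
    using finite_has_maximal2[of ?S A] by blast
  then show thesis
    by (intro that[of K]) (auto simp: cycle_components_def)
qed

text \<open>Otherwise adding the endpoints of the edge would give a larger connected subset of \<open>V\<close>.\<close>

lemma component_closed:
  assumes "K \<in> cycle_components N V" "e \<in> {1..N}" "ends N e \<inter> K \<noteq> {}" "ends N e \<subseteq> V"
  shows "ends N e \<subseteq> K"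
proof -
  have K: "K \<subseteq> V" "connected_sites N K"
    "\<And>K'. K \<subseteq> K' \<Longrightarrow> K' \<subseteq> V \<Longrightarrow> connected_sites N K' \<Longrightarrow> K' = K"
    using assms(1) by (auto simp: cycle_components_def)
  have "K \<union> ends N e = K"
    using connected_sites_extend[OF K(2) assms(2,3)] K(1) assms(4) by (intro K(3)) auto
  then show ?thesis by blast
qed

lemma connected_sites_ring:
  assumes "1 \<le> N"
  shows "connected_sites N {1..N}"
  using connected_sites_reach[of "{1..N}" N 1] reach_eq_ring_iff[of 1 N "{1..N}"] assms by simp

lemma connected_sites_singleton: "i \<in> {1..N} \<Longrightarrow> connected_sites N {i}"
  using connected_sites_reach[of "{}" N i] reach_untouched[of "{}" N "{i}"] by simp

lemma vertex_boundary_ring: "vertex_boundary N {1..N} = {}"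
  using nxt_in[of _ N] nxt_prv[of _ N] by (auto simp: vertex_boundary_def)

text \<open>The boundary vertices of an arc are its last site, where the exit edge starts, and its first site,
  where the entry edge ends. They coincide if the arc is a single site.\<close>

lemma vertex_boundary_proper:
  assumes "K \<subseteq> {1..N}" "exit_edges N K = {r}" "entry_edges N K = {l}"
  shows "vertex_boundary N K = {r, nxt N l}"
proof -
  note r = exit_edge[OF assms(2)] and l = entry_edge[OF assms(3)]
  have "nxt N k \<notin> K \<longleftrightarrow> k = r" if "k \<in> K" for k
    using r(3) r(4)[of k] that assms(1) by blast
  moreover have "prv N k \<notin> K \<longleftrightarrow> k = nxt N l" if "k \<in> K" for k
  proof
    assume out: "prv N k \<notin> K"
    have k: "nxt N (prv N k) = k" "prv N k \<in> {1..N}"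
      using nxt_prv[of k N] that assms(1) by blast+
    then have "prv N k = l"
      using l(4)[of "prv N k"] out that by simp
    then show "k = nxt N l" using k(1) by simp
  next
    assume "k = nxt N l"
    then show "prv N k \<notin> K" using prv_nxt[OF l(1)] l(2) by simp
  qed
  ultimately show ?thesis
    using r(2) l(3) unfolding vertex_boundary_def by blast
qed

text \<open>For an arc \<open>A\<close> inside the component \<open>K\<close>, a boundary edge of \<open>A\<close> has opposite spins exactly if it
  is also a boundary edge of \<open>K\<close>, that is, exactly if the corresponding boundary vertex of \<open>K\<close> belongs
  to \<open>A\<close>. So each of the two ends of \<open>K\<close> is counted once, either as a vertex in \<open>A\<close> or through
  an aligned boundary edge of \<open>A\<close>. If \<open>K\<close> is a single site its two ends are one vertex, and
  \<open>A = K\<close> has no aligned boundary edge.\<close>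

lemma aligned_boundary_in_component:
  assumes "\<sigma> \<in> configs N" "K \<in> cycle_components N (spin_class N \<sigma> s)" "K \<noteq> {1..N}"
    and A: "connected_sites N A" "A \<subseteq> K"
  shows "card (vertex_boundary N K) = 1 \<and> card A = 1 \<and>
      card (edge_boundary N A \<inter> B_plus N \<sigma>) = 0 \<or>
    card (vertex_boundary N K) = 2 \<and>
      card (A \<inter> vertex_boundary N K) + card (edge_boundary N A \<inter> B_plus N \<sigma>) = 2"
proof -
  let ?V = "spin_class N \<sigma> s" and ?B = "B_plus N \<sigma>"
  have K: "K \<subseteq> ?V" "connected_sites N K"
    using assms(2) by (auto simp: cycle_components_def)
  have KN: "K \<subseteq> {1..N}" using connected_sitesD(1)[OF K(2)] .
  obtain r l where rl: "exit_edges N K = {r}" "entry_edges N K = {l}"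
    by (rule connected_proper_boundary[OF K(2) assms(3)])
  have "A \<noteq> {1..N}" using A(2) KN assms(3) by blast
  then obtain r' l' where rl': "exit_edges N A = {r'}" "entry_edges N A = {l'}"
    by (rule connected_proper_boundary[OF A(1)])
  note r = exit_edge[OF rl(1)] and l = entry_edge[OF rl(2)]
  note r' = exit_edge[OF rl'(1)] and l' = entry_edge[OF rl'(2)]
  \<comment> \<open>Since \<open>K\<close> is a component, an edge at \<open>K\<close> is aligned exactly if it stays inside \<open>K\<close>.\<close>
  have open_iff: "e \<in> ?B \<longleftrightarrow> ends N e \<subseteq> K" if e: "e \<in> {1..N}" "ends N e \<inter> K \<noteq> {}" for e
  proof
    assume "e \<in> ?B"
    then have "\<sigma> e = \<sigma> (nxt N e)" using B_plus_eq[OF assms(1)] by blast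
    then have "ends N e \<subseteq> ?V"
      using e K(1) ends_subset[OF e(1)] by (auto simp: ends_def spin_class_def)
    then show "ends N e \<subseteq> K"
      by (rule component_closed[OF assms(2) e])
  next
    assume "ends N e \<subseteq> K"
    then have "ends N e \<subseteq> ?V" using K(1) by blast
    then have "\<sigma> e = \<sigma> (nxt N e)" by (auto simp: ends_def spin_class_def)
    then show "e \<in> ?B" using B_plus_eq[OF assms(1)] e(1) by blast
  qed
  have "r' = r" if "r \<in> A"
    using r'(4)[of r] that r A(2) by blast
  moreover have "r' = r" if "nxt N r' \<notin> K"
    using r(4)[of r'] that r' A(2) by blast
  moreover have "r' \<in> ?B \<longleftrightarrow> nxt N r' \<in> K"
    using open_iff[OF r'(1)] r'(2) A(2) by (auto simp: ends_def)
  ultimately have right: "r' \<in> ?B \<longleftrightarrow> r \<notin> A"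
    using r(3) r'(2) by blast
  have "l' = l" if "nxt N l \<in> A"
    using l'(4)[of l] that l A(2) by blast
  moreover have "l' = l" if "l' \<notin> K"
    using l(4)[of l'] that l' A(2) by blast
  moreover have "l' \<in> ?B \<longleftrightarrow> l' \<in> K"
    using open_iff[OF l'(1)] l'(3) A(2) by (auto simp: ends_def)
  ultimately have left: "l' \<in> ?B \<longleftrightarrow> nxt N l \<notin> A"
    using l(2) l'(3) by blast
  have "r' \<noteq> l'" using r'(2) l'(2) by blast
  moreover have "edge_boundary N A \<inter> ?B = {r', l'} \<inter> ?B"
    using edge_boundary_split(1)[of N A] rl' by auto
  ultimately have b: "card (edge_boundary N A \<inter> ?B) =
      (if r \<in> A then 0 else 1) + (if nxt N l \<in> A then 0 else 1)"
    using right left by (simp add: Int_insert_left)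
  note vb = vertex_boundary_proper[OF KN rl]
  show ?thesis
  proof (cases "r = nxt N l")
    case True
    have "{r} = K"
    proof (rule connected_sites_closed_subset[OF K(2)])
      fix e assume e: "e \<in> inner_edges N K" "ends N e \<inter> {r} \<noteq> {}"
      have "e \<noteq> r" using e(1) r(3) by (auto simp: inner_edges_def ends_def)
      then have "nxt N e = nxt N l" using e(2) True by (auto simp: ends_def)
      moreover have "e \<in> {1..N}" using e(1) by (simp add: inner_edges_def)
      ultimately have "e = l" using prv_nxt[of e N] prv_nxt[OF l(1)] by metis
      then show "ends N e \<subseteq> {r}" using e(1) l(2) by (auto simp: inner_edges_def ends_def)
    qed (simp_all add: r(2))
    then have "A = {r}" using A(2) connected_sitesD(2)[OF A(1)] by blast
    then have "r \<in> A" "nxt N l \<in> A" "card A = 1" using True by simp_all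
    then show ?thesis unfolding vb b using True by simp
  next
    case False
    have "card (A \<inter> {r, nxt N l}) = (if r \<in> A then 1 else 0) + (if nxt N l \<in> A then 1 else 0)"
      using False by (cases "r \<in> A"; cases "nxt N l \<in> A") (simp_all add: Int_insert_right)
    then have "card (A \<inter> vertex_boundary N K) + card (edge_boundary N A \<inter> ?B) = 2"
      unfolding vb b by simp
    moreover have "card (vertex_boundary N K) = 2"
      unfolding vb using False by simp
    ultimately show ?thesis by blast
  qed
qed

lemma component_of_uniform:
  assumes "1 \<le> N" "\<sigma> \<in> configs N" "aligned \<sigma> {1..N}" "K \<in> cycle_components N (spin_class N \<sigma> s)"
  shows "K = {1..N}"
proof -
  have K: "K \<subseteq> spin_class N \<sigma> s" "connected_sites N K"
    "\<And>K'. K \<subseteq> K' \<Longrightarrow> K' \<subseteq> spin_class N \<sigma> s \<Longrightarrow> connected_sites N K' \<Longrightarrow> K' = K"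
    using assms(4) by (auto simp: cycle_components_def)
  note KN = connected_sitesD(1,2)[OF K(2)]
  obtain i where i: "i \<in> K" using KN(2) by blast
  then have "\<sigma> i = s" using K(1) by (auto simp: spin_class_def)
  then have "{1..N} \<subseteq> spin_class N \<sigma> s"
    using aligned_iff[OF assms(2) order_refl, of i] assms(3) i KN(1) by blast
  then show ?thesis
    using K(3)[OF KN(1) _ connected_sites_ring[OF assms(1)]] by simp
qed

lemma comps_eq_spin_class_components:
  "C_comps N \<sigma> = cycle_components N (spin_class N \<sigma> 1)"
  "D_comps N \<sigma> = cycle_components N (spin_class N \<sigma> (- 1))"
  by (simp_all add: C_comps_def D_comps_def spin_class_def)

text \<open>Every spin class that is not empty has a component, so the product vanishes exactly if one of the
  two classes is empty.\<close>

lemma no_opposite_components_iff: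
  assumes "1 \<le> N" "\<sigma> \<in> configs N"
  shows "card (C_comps N \<sigma>) * card (D_comps N \<sigma>) = 0 \<longleftrightarrow> aligned \<sigma> {1..N}"
proof -
  have empty: "cycle_components N (spin_class N \<sigma> s) = {} \<longleftrightarrow> spin_class N \<sigma> s = {}" for s
  proof
    assume no_component: "cycle_components N (spin_class N \<sigma> s) = {}"
    have False if i: "i \<in> spin_class N \<sigma> s" for i
    proof -
      have "i \<in> {1..N}" "spin_class N \<sigma> s \<subseteq> {1..N}" using i by (auto simp: spin_class_def)
      moreover from this have "connected_sites N {i}" "{i} \<subseteq> spin_class N \<sigma> s"
        using i connected_sites_singleton by simp_all
      ultimately obtain K where "K \<in> cycle_components N (spin_class N \<sigma> s)"
        using component_exists[of N "{i}" "spin_class N \<sigma> s"] by meson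
      then show False using no_component by simp
    qed
    then show "spin_class N \<sigma> s = {}" by blast
  next
    assume "spin_class N \<sigma> s = {}"
    then show "cycle_components N (spin_class N \<sigma> s) = {}"
      using connected_sitesD(2) by (auto simp: cycle_components_def)
  qed
  have fin: "finite (cycle_components N (spin_class N \<sigma> s))" for s
    by (intro finite_cycle_components) (auto simp: spin_class_def)
  have "card (C_comps N \<sigma>) * card (D_comps N \<sigma>) = 0 \<longleftrightarrow>
      spin_class N \<sigma> 1 = {} \<or> spin_class N \<sigma> (- 1) = {}"
    by (simp add: comps_eq_spin_class_components fin empty)
  also have "\<dots> \<longleftrightarrow> aligned \<sigma> {1..N}"
  proof
    assume "spin_class N \<sigma> 1 = {} \<or> spin_class N \<sigma> (- 1) = {}"
    then have "\<exists>s. \<forall>i\<in>{1..N}. \<sigma> i = s"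
      using configs_spin[OF assms(2)] unfolding spin_class_def by blast
    then obtain s where s: "\<sigma> i = s" if "i \<in> {1..N}" for i
      by blast
    have "\<sigma> 1 = s"
      using s[of 1] assms(1) by simp
    then have "{1..N} \<subseteq> spin_class N \<sigma> (\<sigma> 1)"
      using s unfolding spin_class_def by blast
    then show "aligned \<sigma> {1..N}"
      using aligned_iff[OF assms(2), of "{1..N}" 1] assms(1) by simp
  next
    assume "aligned \<sigma> {1..N}"
    then have "{1..N} \<subseteq> spin_class N \<sigma> (\<sigma> 1)"
      using aligned_iff[OF assms(2), of "{1..N}" 1] assms(1) by simp
    moreover have "\<sigma> 1 = 1 \<or> \<sigma> 1 = - 1"
      using configs_spin[OF assms(2), of 1] assms(1) by simp
    ultimately show "spin_class N \<sigma> 1 = {} \<or> spin_class N \<sigma> (- 1) = {}"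
      by (auto simp: spin_class_def)
  qed
  finally show ?thesis .
qed

section \<open>The two lists of cases\<close>

text \<open>A proper arc has two boundary edges, of which zero, one or two are aligned; the whole cycle has none
  and is aligned only in a uniform configuration.\<close>

lemma wolff_cases_edge_boundary:
  assumes "1 \<le> N" "\<sigma> \<in> configs N" "connected_sites N A" "aligned \<sigma> A"
  shows "by_cases
    (cluster_weight N J (card A) * kappa_hat J ^ card (edge_boundary N A \<inter> B_plus N \<sigma>))
    [(kappa J ^ (card A - 1) * kappa_hat J ^ 2,
        card (edge_boundary N A \<inter> B_plus N \<sigma>) = 2),
     (kappa J ^ (card A - 1) * kappa_hat J,
        card (edge_boundary N A \<inter> B_plus N \<sigma>) = 1),
     (kappa J ^ (card A - 1),
        edge_boundary N A \<subseteq> B_minus N \<sigma> \<and> card (edge_boundary N A) \<noteq> 0),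
     ((real N * kappa_hat J + kappa J) * kappa J ^ (N - 1),
        card (C_comps N \<sigma>) * card (D_comps N \<sigma>) = 0 \<and> card A = N)]"
proof -
  note sub = connected_sitesD(1)[OF assms(3)]
  show ?thesis
  proof (cases "A = {1..N}")
    case True
    then have "edge_boundary N A = {}" "card A = N"
      "card (C_comps N \<sigma>) * card (D_comps N \<sigma>) = 0"
      using assms(4) no_opposite_components_iff[OF assms(1,2)] edge_boundary_ring[of N] by simp_all
    then show ?thesis
      by (simp add: by_cases_def cluster_weight_def)
  next
    case False
    obtain r l where rl: "exit_edges N A = {r}" "entry_edges N A = {l}"
      by (rule connected_proper_boundary[OF assms(3) False])
    then have D: "edge_boundary N A = {r, l}" "r \<noteq> l"
      using edge_boundary_split[of N A] by auto
    have N: "card A \<noteq> N" using False sub card_eq_ring_iff by simp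
    have pm: "e \<in> B_minus N \<sigma> \<longleftrightarrow> e \<notin> B_plus N \<sigma>" if "e \<in> {1..N}" for e
      using configs_spin[OF assms(2) that] configs_spin[OF assms(2) nxt_in[OF that]] that
      by (auto simp: B_plus_def B_minus_def)
    have "{r, l} \<subseteq> {1..N}" using exit_edge(1)[OF rl(1)] entry_edge(1)[OF rl(2)] by blast
    then have "r \<in> B_minus N \<sigma> \<longleftrightarrow> r \<notin> B_plus N \<sigma>" "l \<in> B_minus N \<sigma> \<longleftrightarrow> l \<notin> B_plus N \<sigma>"
      using pm by blast+
    with N D(2) show ?thesis
      by (simp add: by_cases_def cluster_weight_def D(1) Int_insert_left)
  qed
qed

lemma by_cases_sixI:
  assumes "c1 \<or> c2 \<or> c3 \<or> c4 \<or> c5 \<or> c6"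
    and "c1 \<Longrightarrow> x = v1" "c2 \<Longrightarrow> x = v2" "c3 \<Longrightarrow> x = v3"
    and "c4 \<Longrightarrow> x = v4" "c5 \<Longrightarrow> x = v5" "c6 \<Longrightarrow> x = v6"
  shows "by_cases x [(v1, c1), (v2, c2), (v3, c3), (v4, c4), (v5, c5), (v6, c6)]"
  using assms by (auto simp: by_cases_def)

text \<open>If all spins agree, every component is the whole cycle and has an empty vertex boundary, so only
  the last two conditions can hold. Otherwise \<open>A\<close> lies in a proper component, and the number of
  aligned boundary edges of \<open>A\<close> is two minus the number of ends of that component in \<open>A\<close>, or
  zero if the component is a single site.\<close>

lemma wolff_cases_components:
  assumes "1 \<le> N" "\<sigma> \<in> configs N" "connected_sites N A" "aligned \<sigma> A"
  shows "by_cases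
    (cluster_weight N J (card A) * kappa_hat J ^ card (edge_boundary N A \<inter> B_plus N \<sigma>))
    [(1,
        \<exists>K \<in> C_comps N \<sigma> \<union> D_comps N \<sigma>. A \<subseteq> K \<and> card (vertex_boundary N K) = 1),
     (kappa J ^ (card A - 1) * kappa_hat J ^ 2,
        \<exists>K \<in> C_comps N \<sigma> \<union> D_comps N \<sigma>. A \<subseteq> K \<and> card (vertex_boundary N K) = 2 \<and>
          card (A \<inter> vertex_boundary N K) = 0),
     (kappa J ^ (card A - 1) * kappa_hat J,
        \<exists>K \<in> C_comps N \<sigma> \<union> D_comps N \<sigma>. A \<subseteq> K \<and> card (vertex_boundary N K) = 2 \<and>
          card (A \<inter> vertex_boundary N K) = 1),
     (kappa J ^ (card A - 1),
        \<exists>K \<in> C_comps N \<sigma> \<union> D_comps N \<sigma>. A \<subseteq> K \<and>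
          card (A \<inter> vertex_boundary N K) = 2),
     (kappa J ^ (card A - 1) * kappa_hat J ^ 2,
        card (C_comps N \<sigma>) * card (D_comps N \<sigma>) = 0 \<and> card A \<le> N - 1),
     ((real N * kappa_hat J + kappa J) * kappa J ^ (N - 1),
        card (C_comps N \<sigma>) * card (D_comps N \<sigma>) = 0 \<and> card A = N)]"
    (is "by_cases ?v [(_, ?c1), (_, ?c2), (_, ?c3), (_, ?c4), (_, ?c5), (_, ?c6)]")
proof -
  let ?b = "card (edge_boundary N A \<inter> B_plus N \<sigma>)"
  note sub = connected_sitesD(1,2)[OF assms(3)]
  show ?thesis
  proof (cases "aligned \<sigma> {1..N}")
    case True
    have vb: "vertex_boundary N K = {}" if "K \<in> C_comps N \<sigma> \<union> D_comps N \<sigma>" for K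
    proof -
      have "K = {1..N}"
        using that component_of_uniform[OF assms(1,2) True] by (auto simp: comps_eq_spin_class_components)
      then show ?thesis by (simp only: vertex_boundary_ring)
    qed
    have zero: "card (C_comps N \<sigma>) * card (D_comps N \<sigma>) = 0"
      using no_opposite_components_iff[OF assms(1,2)] True by blast
    have le: "card A \<le> N" using card_mono[OF _ sub(1)] by simp
    have v: "?v = (if card A = N then (real N * kappa_hat J + kappa J) * kappa J ^ (N - 1)
        else kappa J ^ (card A - 1) * kappa_hat J ^ 2)"
    proof (cases "A = {1..N}")
      case True
      then have "edge_boundary N A = {}" using edge_boundary_ring[of N] by simp
      then show ?thesis using True by (simp add: cluster_weight_def)
    next
      case False
      obtain r l where rl: "exit_edges N A = {r}" "entry_edges N A = {l}"
        by (rule connected_proper_boundary[OF assms(3) False])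
      then have D: "edge_boundary N A = {r, l}" "r \<noteq> l"
        using edge_boundary_split[of N A] by auto
      have "e \<in> B_plus N \<sigma>" if "e \<in> {1..N}" for e
        using True that nxt_in[OF that] by (auto simp: B_plus_def aligned_def)
      then have "{r, l} \<inter> B_plus N \<sigma> = {r, l}"
        using exit_edge(1)[OF rl(1)] entry_edge(1)[OF rl(2)] by blast
      then have "?b = 2" using D by simp
      then show ?thesis
        using False sub card_eq_ring_iff by (simp add: cluster_weight_def)
    qed
    have size: "card A \<le> N - 1 \<longleftrightarrow> card A \<noteq> N" using le assms(1) by linarith
    show ?thesis
    proof (rule by_cases_sixI)
      have "?c5 \<or> ?c6" using zero size by simp
      then show "?c1 \<or> ?c2 \<or> ?c3 \<or> ?c4 \<or> ?c5 \<or> ?c6"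
        by (rule disjI2[OF disjI2[OF disjI2[OF disjI2]]])
    next
      assume ?c1
      then show "?v = 1" using vb by fastforce
    next
      assume ?c2
      then show "?v = kappa J ^ (card A - 1) * kappa_hat J ^ 2" using vb by fastforce
    next
      assume ?c3
      then show "?v = kappa J ^ (card A - 1) * kappa_hat J" using vb by fastforce
    next
      assume ?c4
      then show "?v = kappa J ^ (card A - 1)" using vb by fastforce
    next
      assume ?c5
      then show "?v = kappa J ^ (card A - 1) * kappa_hat J ^ 2"
        using size unfolding v by simp
    next
      assume ?c6
      then show "?v = (real N * kappa_hat J + kappa J) * kappa J ^ (N - 1)"
        unfolding v by simp
    qed
  next
    case False
    have nonzero: "card (C_comps N \<sigma>) * card (D_comps N \<sigma>) \<noteq> 0"
      using no_opposite_components_iff[OF assms(1,2)] False by blast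
    have N: "card A \<noteq> N" using False assms(4) sub card_eq_ring_iff by auto
    have comp: "card (vertex_boundary N K) = 1 \<and> card A = 1 \<and> ?b = 0 \<or>
        card (vertex_boundary N K) = 2 \<and> card (A \<inter> vertex_boundary N K) + ?b = 2"
      if K: "K \<in> C_comps N \<sigma> \<union> D_comps N \<sigma>" "A \<subseteq> K" for K
    proof -
      obtain s where s: "K \<in> cycle_components N (spin_class N \<sigma> s)"
        using K(1) by (auto simp: comps_eq_spin_class_components)
      then have "K \<subseteq> spin_class N \<sigma> s" "connected_sites N K"
        by (auto simp: cycle_components_def)
      moreover from this obtain i where "i \<in> K" "\<sigma> i = s"
        using connected_sitesD(2)[of N K] by (auto simp: spin_class_def)
      ultimately have "aligned \<sigma> K"
        using aligned_iff[OF assms(2), of K i] connected_sitesD(1)[of N K] by blast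
      then have "K \<noteq> {1..N}" using False by blast
      then show ?thesis
        by (rule aligned_boundary_in_component[OF assms(2) s _ assms(3) K(2)])
    qed
    have le: "card (A \<inter> vertex_boundary N K) \<le> card (vertex_boundary N K)"
      if "card (vertex_boundary N K) = 1" for K
      using that by (intro card_mono) (auto intro: card_ge_0_finite)
    obtain K where K: "K \<in> C_comps N \<sigma> \<union> D_comps N \<sigma>" "A \<subseteq> K"
    proof -
      obtain i where i: "i \<in> A" using sub by blast
      have "A \<subseteq> spin_class N \<sigma> (\<sigma> i)"
        using aligned_iff[OF assms(2) sub(1) i] assms(4) by blast
      moreover have "spin_class N \<sigma> (\<sigma> i) \<subseteq> {1..N}"
        by (auto simp: spin_class_def)
      ultimately obtain K where "K \<in> cycle_components N (spin_class N \<sigma> (\<sigma> i))" "A \<subseteq> K"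
        by (rule component_exists[OF assms(3)])
      moreover have "\<sigma> i = 1 \<or> \<sigma> i = - 1"
        using configs_spin[OF assms(2)] i sub(1) by blast
      ultimately have "K \<in> C_comps N \<sigma> \<union> D_comps N \<sigma>"
        by (auto simp: comps_eq_spin_class_components)
      then show thesis
        using \<open>A \<subseteq> K\<close> by (rule that)
    qed
    have v: "?v = kappa J ^ (card A - 1) * kappa_hat J ^ ?b"
      using N by (simp add: cluster_weight_def)
    have weight: "?v = kappa J ^ (card A - 1) * kappa_hat J ^ m"
      if "K \<in> C_comps N \<sigma> \<union> D_comps N \<sigma>" "A \<subseteq> K" "card (vertex_boundary N K) = 2"
        "card (A \<inter> vertex_boundary N K) = n" "n + m = 2" for K m n
    proof -
      have "?b = m" using comp[OF that(1,2)] that by linarith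
      then show ?thesis unfolding v by (rule arg_cong)
    qed
    show ?thesis
    proof (rule by_cases_sixI)
      have small: "n = 0 \<or> n = 1 \<or> n = 2" if "n + m = 2" for n m :: nat
        using that by arith
      consider "card (vertex_boundary N K) = 1"
        | "card (vertex_boundary N K) = 2" "card (A \<inter> vertex_boundary N K) = 0"
        | "card (vertex_boundary N K) = 2" "card (A \<inter> vertex_boundary N K) = 1"
        | "card (vertex_boundary N K) = 2" "card (A \<inter> vertex_boundary N K) = 2"
        using comp[OF K] small by metis
      then show "?c1 \<or> ?c2 \<or> ?c3 \<or> ?c4 \<or> ?c5 \<or> ?c6"
      proof cases
        case 1
        then have ?c1 using K by blast
        then show ?thesis by (rule disjI1)
      next
        case 2
        then have ?c2 using K by blast
        then show ?thesis by (rule disjI2[OF disjI1])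
      next
        case 3
        then have ?c3 using K by blast
        then show ?thesis by (rule disjI2[OF disjI2[OF disjI1]])
      next
        case 4
        then have ?c4 using K by blast
        then show ?thesis by (rule disjI2[OF disjI2[OF disjI2[OF disjI1]]])
      qed
    next
      assume ?c1
      then obtain K where K: "K \<in> C_comps N \<sigma> \<union> D_comps N \<sigma>" "A \<subseteq> K" "card (vertex_boundary N K) = 1"
        by blast
      show "?v = 1"
        unfolding v using comp[OF K(1,2)] K(3) by simp
    next
      assume ?c2
      then show "?v = kappa J ^ (card A - 1) * kappa_hat J ^ 2"
        using weight[where n = 0 and m = 2] by auto
    next
      assume ?c3
      then show "?v = kappa J ^ (card A - 1) * kappa_hat J"
        using weight[where n = 1 and m = 1] by auto
    next
      assume ?c4
      then obtain K where K: "K \<in> C_comps N \<sigma> \<union> D_comps N \<sigma>" "A \<subseteq> K"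
        "card (A \<inter> vertex_boundary N K) = 2"
        by blast
      have "card (vertex_boundary N K) = 2"
        using comp[OF K(1,2)] le[of K] K(3) by linarith
      then show "?v = kappa J ^ (card A - 1)"
        using weight[where n = 2 and m = 0, OF K(1,2)] K(3) by simp
    next
      assume ?c5
      then show "?v = kappa J ^ (card A - 1) * kappa_hat J ^ 2" using nonzero by blast
    next
      assume ?c6
      then show "?v = (real N * kappa_hat J + kappa J) * kappa J ^ (N - 1)" using nonzero by blast
    qed
  qed
qed

section \<open>Transition probabilities and reversibility\<close>

theorem theorem3p1:
  fixes N :: nat
  assumes "N \<ge> 1"
  shows
    "(\<forall>J > 0. \<forall>\<sigma> \<in> configs N.
       (\<forall>A \<subseteq> {1..N}. connected_sites N A \<and> aligned \<sigma> A \<longrightarrow>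
          (\<exists>v. P_W N J \<sigma> (flip A \<sigma>) = real (card A) / real N * v \<and>
            by_cases v
              [(kappa J ^ (card A - 1) * kappa_hat J ^ 2,
                  card (edge_boundary N A \<inter> B_plus N \<sigma>) = 2),
               (kappa J ^ (card A - 1) * kappa_hat J,
                  card (edge_boundary N A \<inter> B_plus N \<sigma>) = 1),
               (kappa J ^ (card A - 1),
                  edge_boundary N A \<subseteq> B_minus N \<sigma> \<and> card (edge_boundary N A) \<noteq> 0),
               ((real N * kappa_hat J + kappa J) * kappa J ^ (N - 1),
                  card (C_comps N \<sigma>) * card (D_comps N \<sigma>) = 0 \<and> card A = N)]) \<and>
          (\<exists>v. P_W N J \<sigma> (flip A \<sigma>) = real (card A) / real N * v \<and>
            by_cases v
              [(1,
                  \<exists>K \<in> C_comps N \<sigma> \<union> D_comps N \<sigma>. A \<subseteq> K \<and> card (vertex_boundary N K) = 1),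
               (kappa J ^ (card A - 1) * kappa_hat J ^ 2,
                  \<exists>K \<in> C_comps N \<sigma> \<union> D_comps N \<sigma>. A \<subseteq> K \<and> card (vertex_boundary N K) = 2 \<and>
                    card (A \<inter> vertex_boundary N K) = 0),
               (kappa J ^ (card A - 1) * kappa_hat J,
                  \<exists>K \<in> C_comps N \<sigma> \<union> D_comps N \<sigma>. A \<subseteq> K \<and> card (vertex_boundary N K) = 2 \<and>
                    card (A \<inter> vertex_boundary N K) = 1),
               (kappa J ^ (card A - 1),
                  \<exists>K \<in> C_comps N \<sigma> \<union> D_comps N \<sigma>. A \<subseteq> K \<and>
                    card (A \<inter> vertex_boundary N K) = 2),
               (kappa J ^ (card A - 1) * kappa_hat J ^ 2,
                  card (C_comps N \<sigma>) * card (D_comps N \<sigma>) = 0 \<and> card A \<le> N - 1),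
               ((real N * kappa_hat J + kappa J) * kappa J ^ (N - 1),
                  card (C_comps N \<sigma>) * card (D_comps N \<sigma>) = 0 \<and> card A = N)])) \<and>
       (\<forall>A \<subseteq> {1..N}. \<not> connected_sites N A \<or> \<not> aligned \<sigma> A \<longrightarrow> P_W N J \<sigma> (flip A \<sigma>) = 0)) \<and>
     (\<forall>\<sigma> \<in> configs N.
       (\<forall>A \<subseteq> {1..N}. card A \<ge> 2 \<longrightarrow> P_W N 0 \<sigma> (flip A \<sigma>) = 0) \<and>
       (\<forall>i \<in> {1..N}. P_W N 0 \<sigma> (flip {i} \<sigma>) = 1 / real N) \<and>
       wolff N 0 \<sigma> = hypercube_srw N \<sigma>) \<and>
     (\<forall>J \<ge> 0. \<forall>\<eta> \<in> configs N. \<forall>\<sigma> \<in> configs N.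
       gibbs N J \<eta> * P_W N J \<eta> \<sigma> = gibbs N J \<sigma> * P_W N J \<sigma> \<eta>)"
proof (intro conjI allI impI ballI)
  fix J :: real and \<sigma> A
  assume J: "0 < J" and \<sigma>: "\<sigma> \<in> configs N" and "A \<subseteq> {1..N}"
    and A: "connected_sites N A \<and> aligned \<sigma> A"
  note kernel = wolff_kernel[OF assms less_imp_le[OF J] \<sigma>, of A]
  show "\<exists>v. P_W N J \<sigma> (flip A \<sigma>) = real (card A) / real N * v \<and>
      by_cases v
        [(kappa J ^ (card A - 1) * kappa_hat J ^ 2,
            card (edge_boundary N A \<inter> B_plus N \<sigma>) = 2),
         (kappa J ^ (card A - 1) * kappa_hat J,
            card (edge_boundary N A \<inter> B_plus N \<sigma>) = 1),
         (kappa J ^ (card A - 1),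
            edge_boundary N A \<subseteq> B_minus N \<sigma> \<and> card (edge_boundary N A) \<noteq> 0),
         ((real N * kappa_hat J + kappa J) * kappa J ^ (N - 1),
            card (C_comps N \<sigma>) * card (D_comps N \<sigma>) = 0 \<and> card A = N)]"
    using kernel wolff_cases_edge_boundary[OF assms \<sigma>, of A J] A by blast
  show "\<exists>v. P_W N J \<sigma> (flip A \<sigma>) = real (card A) / real N * v \<and>
      by_cases v
        [(1,
            \<exists>K \<in> C_comps N \<sigma> \<union> D_comps N \<sigma>. A \<subseteq> K \<and> card (vertex_boundary N K) = 1),
         (kappa J ^ (card A - 1) * kappa_hat J ^ 2,
            \<exists>K \<in> C_comps N \<sigma> \<union> D_comps N \<sigma>. A \<subseteq> K \<and> card (vertex_boundary N K) = 2 \<and>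
              card (A \<inter> vertex_boundary N K) = 0),
         (kappa J ^ (card A - 1) * kappa_hat J,
            \<exists>K \<in> C_comps N \<sigma> \<union> D_comps N \<sigma>. A \<subseteq> K \<and> card (vertex_boundary N K) = 2 \<and>
              card (A \<inter> vertex_boundary N K) = 1),
         (kappa J ^ (card A - 1),
            \<exists>K \<in> C_comps N \<sigma> \<union> D_comps N \<sigma>. A \<subseteq> K \<and>
              card (A \<inter> vertex_boundary N K) = 2),
         (kappa J ^ (card A - 1) * kappa_hat J ^ 2,
            card (C_comps N \<sigma>) * card (D_comps N \<sigma>) = 0 \<and> card A \<le> N - 1),
         ((real N * kappa_hat J + kappa J) * kappa J ^ (N - 1),
            card (C_comps N \<sigma>) * card (D_comps N \<sigma>) = 0 \<and> card A = N)]"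
    using kernel wolff_cases_components[OF assms \<sigma>, of A J] A by blast
next
  fix J :: real and \<sigma> A
  assume "0 < J" "\<sigma> \<in> configs N" "A \<subseteq> {1..N}" "\<not> connected_sites N A \<or> \<not> aligned \<sigma> A"
  then show "P_W N J \<sigma> (flip A \<sigma>) = 0"
    using wolff_kernel_eq_0[OF assms, of J \<sigma> A] by simp
next
  fix \<sigma> A
  assume "\<sigma> \<in> configs N" "A \<subseteq> {1..N}" "2 \<le> card A"
  moreover from this have "{i \<in> {1..N}. {i} = A} = {}" by auto
  ultimately show "P_W N 0 \<sigma> (flip A \<sigma>) = 0"
    using P_W_zero_coupling[OF assms] by simp
next
  fix \<sigma> i
  assume "\<sigma> \<in> configs N" "i \<in> {1..N}"
  moreover from this have "{j \<in> {1..N}. {j} = {i}} = {i}" by auto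
  ultimately show "P_W N 0 \<sigma> (flip {i} \<sigma>) = 1 / real N"
    using P_W_zero_coupling[OF assms, of \<sigma> "{i}"] by simp
next
  fix \<sigma> assume "\<sigma> \<in> configs N"
  then show "wolff N 0 \<sigma> = hypercube_srw N \<sigma>" by (rule wolff_zero_coupling[OF assms])
next
  fix J :: real and \<eta> \<sigma> assume "0 \<le> J" "\<eta> \<in> configs N" "\<sigma> \<in> configs N"
  then show "gibbs N J \<eta> * P_W N J \<eta> \<sigma> = gibbs N J \<sigma> * P_W N J \<sigma> \<eta>"
    by (rule wolff_detailed_balance[OF assms])
qed

end
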